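(* Every local triple derivation on a C$^*$-algebra is a triple derivation.
   Context: A C$^*$-algebra $A$ (not necessarily unital) is equipped with the triple product $\{x,y,z\}=\frac12(xy^*z+zy^*x)$. A triple derivation on $A$ is a linear map $\delta:A\to A$ with $\delta\{a,b,c\}=\{\delta(a),b,c\}+\{a,\delta(b),c\}+\{a,b,\delta(c)\}$ for all $a,b,c\in A$. A local triple derivation on $A$ is a linear map $T:A\to A$ (not assumed continuous) such that for each $a\in A$ there exists a triple derivation $\delta_a$ on $A$ with $T(a)=\delta_a(a)$. *)

theory Defs
  imports "HOL-Analysis.Analysis"
begin

text \<open>
  A type of class \<open>cstar_algebra\<close> is a complex C*-algebra. No unit is assumed, and the zero
  algebra is admitted. The axioms \<open>scaleR_eq_scaleC\<close> and \<open>norm_scaleC\<close> tie the complex structure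
  to the real Banach algebra structure of \<^class>\<open>real_normed_algebra\<close> and \<^class>\<open>banach\<close>;
  completeness and submultiplicativity of the norm are inherited from there.
\<close>

class cstar_algebra = real_normed_algebra + banach +
  fixes scaleC :: "complex \<Rightarrow> 'a \<Rightarrow> 'a"  (infixr "*\<^sub>C" 75)
    and star :: "'a \<Rightarrow> 'a"
  assumes scaleC_add_right: "c *\<^sub>C (x + y) = c *\<^sub>C x + c *\<^sub>C y"
    and scaleC_add_left: "(c + d) *\<^sub>C x = c *\<^sub>C x + d *\<^sub>C x"
    and scaleC_scaleC: "c *\<^sub>C d *\<^sub>C x = (c * d) *\<^sub>C x"
    and scaleR_eq_scaleC: "r *\<^sub>R x = complex_of_real r *\<^sub>C x"
    and norm_scaleC: "norm (c *\<^sub>C x) = cmod c * norm x"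
    and mult_scaleC_left: "c *\<^sub>C x * y = c *\<^sub>C (x * y)"
    and mult_scaleC_right: "x * c *\<^sub>C y = c *\<^sub>C (x * y)"
    and star_star: "star (star x) = x"
    and star_add: "star (x + y) = star x + star y"
    and star_scaleC: "star (c *\<^sub>C x) = cnj c *\<^sub>C star x"
    and star_mult: "star (x * y) = star y * star x"
    and cstar_identity: "norm (star x * x) = (norm x)\<^sup>2"

lemma vector_space_scaleC: "vector_space (scaleC :: complex \<Rightarrow> 'a \<Rightarrow> 'a::cstar_algebra)"
proof
  fix x :: 'a
  show "1 *\<^sub>C x = x"
    using scaleR_eq_scaleC[of 1 x] by simp
qed (simp_all add: scaleC_add_right scaleC_add_left scaleC_scaleC)

abbreviation clinear :: "('a::cstar_algebra \<Rightarrow> 'b::cstar_algebra) \<Rightarrow> bool"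
  where "clinear \<equiv> Vector_Spaces.linear scaleC scaleC"

definition triple_product :: "'a::cstar_algebra \<Rightarrow> 'a \<Rightarrow> 'a \<Rightarrow> 'a"
  where "triple_product x y z = (x * star y * z + z * star y * x) /\<^sub>R 2"

definition triple_derivation :: "('a::cstar_algebra \<Rightarrow> 'a) \<Rightarrow> bool"
  where "triple_derivation \<delta> \<longleftrightarrow>
    clinear \<delta> \<and>
    (\<forall>a b c. \<delta> (triple_product a b c) =
      triple_product (\<delta> a) b c + triple_product a (\<delta> b) c + triple_product a b (\<delta> c))"

definition local_triple_derivation :: "('a::cstar_algebra \<Rightarrow> 'a) \<Rightarrow> bool"
  where "local_triple_derivation T \<longleftrightarrow>
    clinear T \<and> (\<forall>a. \<exists>\<delta>. triple_derivation \<delta> \<and> T a = \<delta> a)"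

end

theory Submission
  imports Defs
begin

text \<open>
  Local triple derivations are triple derivations because both notions can be recognised from the
  norm: a complex linear map \<open>T\<close> with \<open>\<parallel>x\<parallel> \<le> \<parallel>x - t T x\<parallel>\<close> for all \<open>x\<close> and all real \<open>t\<close> is a triple
  derivation, and this condition tests \<open>T\<close> at one vector at a time, so that it passes from
  derivations to local derivations.

  That a triple derivation \<open>\<delta>\<close> satisfies the condition is seen from the cubic
  \<open>f y = (3 y - y y\<^sup>* y) / 2\<close>. It maps the ball of radius \<open>\<surd>2\<close> into the unit ball
  (\<open>cubic_norm_le\<close>) and the closed unit ball onto itself (\<open>cubic_preimage_exists\<close>). If \<open>x = f y\<close>,
  then \<open>\<delta> x\<close> is the derivative of \<open>f\<close> at \<open>y\<close> in the direction \<open>\<delta> y\<close>, hence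
  \<open>\<parallel>x + t \<delta> x\<parallel> = \<parallel>f (y + t \<delta> y)\<parallel> + O(t\<^sup>2) \<le> 1 + O(t\<^sup>2)\<close>, without any continuity of \<open>\<delta>\<close>
  (\<open>triple_derivation_tangent\<close>). Convexity of the norm turns this into the condition above.

  Conversely, the condition makes \<open>T\<close> bounded, by the closed graph argument
  (\<open>dissipative_bounded\<close>), and the operators \<open>exp (s T)\<close> form a group of linear isometries
  (\<open>dissipative_flow\<close>). A surjective linear isometry \<open>g\<close> of a C*-algebra preserves the triple
  product (\<open>isometry_preserves_triple\<close>; the theorem of Kadison, here with the proof of Kaup):
  the vector fields \<open>z \<mapsto> a - z a\<^sup>* z\<close> are tangent to the unit sphere (\<open>tangent_norm_le\<close>); the
  transform of this field under \<open>g\<close> and the field for \<open>g a\<close> agree at \<open>0\<close>, so that their difference is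
  a homogeneous quadratic tangent field, and such a field vanishes by an argument in the style of
  Liouville's theorem (\<open>tangent_quadratic_zero\<close>). Differentiating the identity
  \<open>g (x a\<^sup>* x) = (g x) (g a)\<^sup>* (g x)\<close> for \<open>g = exp (s T)\<close> at \<open>s = 0\<close> and polarising gives the claim.

  The two norm estimates \<open>cubic_norm_le\<close> and \<open>tangent_norm_le\<close> are where the C*-structure enters.
  Both reduce to \<open>\<parallel>1 - v\<^sup>* v\<parallel> \<le> 1\<close> for \<open>\<parallel>v\<parallel>\<^sup>2 \<le> 2\<close>, that is, to the positivity of \<open>v\<^sup>* v\<close> in a
  unital C*-algebra; an arbitrary C*-algebra is embedded into its multiplier algebra for this
  purpose. Positivity is developed from square roots given by power series, without spectral
  theory.
\<close>

section \<open>Elementary consequences of the C*-axioms\<close>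

lemma scaleC_one [simp]: "1 *\<^sub>C x = (x::'a::cstar_algebra)"
  using scaleR_eq_scaleC[of 1 x] by simp

lemma scaleC_zero [simp]: "0 *\<^sub>C x = (0::'a::cstar_algebra)"
  using scaleR_eq_scaleC[of 0 x] by simp

lemma scaleC_minus_one: "(-1) *\<^sub>C x = - (x::'a::cstar_algebra)"
  using scaleR_eq_scaleC[of "-1" x] by simp

lemma scaleC_zero_right [simp]: "c *\<^sub>C 0 = (0::'a::cstar_algebra)"
  using scaleC_add_right[of c 0 "0::'a"] by simp

lemma scaleC_minus_right: "c *\<^sub>C (- x) = - (c *\<^sub>C (x::'a::cstar_algebra))"
  using scaleC_add_right[of c x "-x"] by (simp add: minus_unique)

lemma scaleC_diff_right: "c *\<^sub>C (x - y) = c *\<^sub>C x - c *\<^sub>C (y::'a::cstar_algebra)"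
  using scaleC_add_right[of c x "-y"] by (simp add: scaleC_minus_right)

lemma scaleC_minus_left: "(- c) *\<^sub>C x = - (c *\<^sub>C (x::'a::cstar_algebra))"
  using scaleC_add_left[of c "-c" x] by (simp add: minus_unique)

lemma scaleC_scaleR: "c *\<^sub>C (r *\<^sub>R x) = r *\<^sub>R (c *\<^sub>C (x::'a::cstar_algebra))"
  by (simp add: scaleR_eq_scaleC scaleC_scaleC mult.commute)

lemma star_zero [simp]: "star (0::'a::cstar_algebra) = 0"
  using star_add[of 0 "0::'a"] by simp

lemma star_minus: "star (- x) = - star (x::'a::cstar_algebra)"
  using star_add[of x "-x"] by (simp add: minus_unique)

lemma star_diff: "star (x - y) = star x - star (y::'a::cstar_algebra)"
  using star_add[of x "-y"] by (simp add: star_minus)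

lemma star_scaleR: "star (r *\<^sub>R x) = r *\<^sub>R star (x::'a::cstar_algebra)"
  by (simp add: scaleR_eq_scaleC star_scaleC)

lemmas star_simps = star_add star_diff star_minus star_scaleR star_mult star_star star_scaleC

lemma norm_star [simp]: "norm (star x) = norm (x::'a::cstar_algebra)"
proof -
  have le: "norm y \<le> norm (star y)" for y :: 'a
  proof (cases "y = 0")
    case False
    have "norm y * norm y \<le> norm (star y) * norm y"
      using norm_mult_ineq[of "star y" y] by (simp add: cstar_identity power2_eq_square)
    then show ?thesis using False by simp
  qed simp
  show ?thesis using le[of x] le[of "star x"] by (simp add: star_star)
qed

lemma cstar_identity': "norm (x * star x) = (norm (x::'a::cstar_algebra))\<^sup>2"
  using cstar_identity[of "star x"] by (simp add: star_star)

lemma norm_selfadjoint_square: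
  "star h = h \<Longrightarrow> norm (h * h) = (norm (h::'a::cstar_algebra))\<^sup>2"
  using cstar_identity[of h] by simp

lemma bounded_linear_star: "bounded_linear (star :: 'a \<Rightarrow> 'a::cstar_algebra)"
  by (rule bounded_linear_intro[where K=1]) (simp_all add: star_simps)

lemmas tendsto_star = bounded_linear.tendsto[OF bounded_linear_star]

lemma bounded_linear_scaleC: "bounded_linear (\<lambda>x::'a::cstar_algebra. c *\<^sub>C x)"
  by (rule bounded_linear_intro[where K="cmod c"])
    (simp_all add: scaleC_add_right scaleC_scaleR norm_scaleC mult.commute)

lemma clinearD:
  assumes "clinear (f :: 'a::cstar_algebra \<Rightarrow> 'a)"
  shows "f (x + y) = f x + f y" "f (c *\<^sub>C x) = c *\<^sub>C f x" "f (r *\<^sub>R x) = r *\<^sub>R f x"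
    "f (x - y) = f x - f y" "f 0 = 0" "linear f"
proof -
  interpret Vector_Spaces.linear scaleC scaleC f by (rule assms)
  show "f (x + y) = f x + f y" "f (c *\<^sub>C x) = c *\<^sub>C f x" "f (r *\<^sub>R x) = r *\<^sub>R f x"
    "f (x - y) = f x - f y" "f 0 = 0"
    by (simp_all add: add scale diff zero scaleR_eq_scaleC)
  show "linear f"
    by (rule Real_Vector_Spaces.linearI) (simp_all add: add scale scaleR_eq_scaleC)
qed

lemma clinearI:
  assumes "\<And>x y. f (x + y) = f x + f y" "\<And>c x. f (c *\<^sub>C x) = c *\<^sub>C f x"
  shows "clinear (f :: 'a::cstar_algebra \<Rightarrow> 'a)"
  using assms vector_space_scaleC
  unfolding Vector_Spaces.linear_def module_hom_def module_hom_axioms_def vector_space_def module_def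
  by blast

section \<open>Solving quadratic and cubic equations by majorised iteration\<close>

text \<open>
  A fixed point iteration in a Banach space converges if its increments are dominated by those of the
  corresponding scalar iteration. This also covers the boundary case, where the scalar iteration
  converges to a point at which it is not contracting.
\<close>

lemma majorised_iteration:
  fixes y :: "nat \<Rightarrow> 'a::banach" and s :: "nat \<Rightarrow> real"
  assumes y0: "y 0 = 0" and s0: "s 0 = 0" and s1: "\<And>n. s n \<le> 1"
    and base: "norm (y 1) \<le> s 1"
    and step: "\<And>n. norm (y n) \<le> s n \<Longrightarrow> norm (y (Suc n)) \<le> s (Suc n)
      \<Longrightarrow> norm (y (Suc n) - y n) \<le> s (Suc n) - s n
      \<Longrightarrow> norm (y (Suc (Suc n)) - y (Suc n)) \<le> s (Suc (Suc n)) - s (Suc n)"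
  obtains l where "y \<longlonglongrightarrow> l" "norm l \<le> 1"
proof -
  have inv: "norm (y n) \<le> s n \<and> norm (y (Suc n) - y n) \<le> s (Suc n) - s n" for n
  proof (induction n)
    case 0
    then show ?case using y0 s0 base by simp
  next
    case (Suc n)
    have "norm (y (Suc n)) \<le> norm (y n) + norm (y (Suc n) - y n)"
      using norm_triangle_ineq[of "y n" "y (Suc n) - y n"] by simp
    with Suc have "norm (y (Suc n)) \<le> s (Suc n)" by linarith
    with Suc step show ?case by blast
  qed
  have incs: "incseq s"
    by (rule incseq_SucI) (smt (verit) inv norm_ge_zero)
  have diff: "norm (y (n + k) - y n) \<le> s (n + k) - s n" for n k
  proof (induction k)
    case (Suc k)
    have "norm (y (n + Suc k) - y n) \<le> norm (y (Suc (n + k)) - y (n + k)) + norm (y (n + k) - y n)"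
      using norm_triangle_ineq[of "y (Suc (n + k)) - y (n + k)" "y (n + k) - y n"] by simp
    with Suc inv[of "n + k"] show ?case by simp
  qed simp
  have "convergent s"
    by (rule incseq_convergent[OF incs, of 1]) (use s1 convergentI in blast)+
  then have "Cauchy s" by (rule convergent_Cauchy)
  have "Cauchy y"
  proof (rule metric_CauchyI)
    fix e :: real assume "e > 0"
    then obtain N where N: "\<And>m n. m \<ge> N \<Longrightarrow> n \<ge> N \<Longrightarrow> dist (s m) (s n) < e"
      using \<open>Cauchy s\<close> by (meson metric_CauchyD)
    have "dist (y m) (y n) < e" if "m \<ge> N" "n \<ge> N" for m n
    proof -
      have "dist (y (a + k)) (y a) < e" if "a \<ge> N" for a k
        using diff[of a k] N[of "a + k" a] that by (simp add: dist_norm) 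
      then show ?thesis
        using that by (metis dist_commute le_add_diff_inverse nle_le)
    qed
    then show "\<exists>M. \<forall>m\<ge>M. \<forall>n\<ge>M. dist (y m) (y n) < e" by blast
  qed
  then obtain l where l: "y \<longlonglongrightarrow> l"
    using Cauchy_convergent convergent_def by blast
  moreover have "norm l \<le> 1"
    by (rule LIMSEQ_le_const2[OF tendsto_norm[OF l]]) (use inv s1 order_trans in blast)
  ultimately show thesis using that by blast
qed

text \<open>
  The element \<open>1 - m\<close> is a square root of \<open>1 - p\<close>; in terms of \<open>m\<close> no unit is involved. The iteration
  \<open>m \<mapsto> (p + m\<^sup>2) / 2\<close> sums the binomial series. Its scalar majorant, with \<open>p = 1\<close>, increases to \<open>1\<close>.
\<close>

lemma sqrt_exists:
  fixes p :: "'a::cstar_algebra"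
  assumes "star p = p" "norm p \<le> 1"
  obtains m where "star m = m" "norm m \<le> 1" "2 *\<^sub>R m - m * m = p"
    "\<And>c. c * p = p * c \<Longrightarrow> c * m = m * c"
proof -
  define y where "y = rec_nat 0 (\<lambda>_ z. (p + z * z) /\<^sub>R 2)"
  have yS: "y 0 = 0" "y (Suc n) = (p + y n * y n) /\<^sub>R 2" for n
    by (simp_all add: y_def)
  define s :: "nat \<Rightarrow> real" where "s = rec_nat 0 (\<lambda>_ z. (1 + z * z) / 2)"
  have sS: "s 0 = 0" "s (Suc n) = (1 + s n * s n) / 2" for n
    by (simp_all add: s_def)
  have s01: "0 \<le> s n \<and> s n \<le> 1" for n
    by (induction n) (auto simp: sS mult_le_one)
  obtain m where lim: "y \<longlonglongrightarrow> m" and m1: "norm m \<le> 1"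
  proof (rule majorised_iteration[of y s])
    show "norm (y 1) \<le> s 1" using assms yS(2)[of 0] sS(2)[of 0] by (simp add: yS(1) sS(1))
  next
    fix n assume n: "norm (y n) \<le> s n" "norm (y (Suc n)) \<le> s (Suc n)"
      "norm (y (Suc n) - y n) \<le> s (Suc n) - s n"
    let ?a = "y (Suc n)" and ?b = "y n"
    have "y (Suc (Suc n)) - y (Suc n) = (?a * ?a - ?b * ?b) /\<^sub>R 2"
      by (subst yS(2)[of "Suc n"], subst (3) yS(2)[of n]) (simp add: algebra_simps)
    also have "?a * ?a - ?b * ?b = ?a * (?a - ?b) + (?a - ?b) * ?b"
      by (simp add: algebra_simps)
    finally have "norm (y (Suc (Suc n)) - y (Suc n)) \<le> (norm ?a * norm (?a - ?b) + norm (?a - ?b) * norm ?b) / 2"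
      using norm_triangle_ineq[of "?a * (?a - ?b)" "(?a - ?b) * ?b"]
        norm_mult_ineq[of ?a "?a - ?b"] norm_mult_ineq[of "?a - ?b" ?b] by simp
    also have "\<dots> \<le> (s (Suc n) * (s (Suc n) - s n) + (s (Suc n) - s n) * s n) / 2"
      using n s01 order_trans[OF norm_ge_zero n(3)] by (intro divide_right_mono add_mono mult_mono) auto
    also have "\<dots> = s (Suc (Suc n)) - s (Suc n)"
      by (subst sS(2)[of "Suc n"], subst (5) sS(2)[of n]) (simp add: field_simps)
    finally show "norm (y (Suc (Suc n)) - y (Suc n)) \<le> s (Suc (Suc n)) - s (Suc n)" .
  qed (use yS sS s01 in auto)
  have "(\<lambda>n. y (Suc n)) \<longlonglongrightarrow> (p + m * m) /\<^sub>R 2"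
    unfolding yS by (intro tendsto_intros lim)
  moreover have "(\<lambda>n. y (Suc n)) \<longlonglongrightarrow> m" using lim by (rule LIMSEQ_Suc)
  ultimately have fix_eq: "m = (p + m * m) /\<^sub>R 2" using LIMSEQ_unique by blast
  have "2 *\<^sub>R m - m * m = p"
    by (subst (1) fix_eq) simp
  moreover have "star m = m"
  proof -
    have "star (y n) = y n" for n
      by (induction n) (simp_all add: yS star_simps assms)
    then show ?thesis using tendsto_star[OF lim] lim by (simp add: LIMSEQ_unique)
  qed
  moreover have "c * m = m * c" if "c * p = p * c" for c
  proof -
    have "c * y n = y n * c" for n
    proof (induction n)
      case (Suc n)
      have "c * (y n * y n) = (y n * y n) * c" using Suc by (metis mult.assoc)
      then show ?case using that by (simp add: yS distrib_left distrib_right)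
    qed (simp add: yS)
    moreover have "(\<lambda>n. c * y n) \<longlonglongrightarrow> c * m" "(\<lambda>n. y n * c) \<longlonglongrightarrow> m * c"
      by (intro tendsto_intros lim)+
    ultimately show ?thesis by (simp add: LIMSEQ_unique)
  qed
  ultimately show thesis using that m1 by blast
qed

text \<open>
  The cubic \<open>s \<mapsto> (3 s - s\<^sup>3) / 2\<close> maps \<open>[0, 1]\<close> onto itself, and its inverse has a power series with
  nonnegative coefficients of sum \<open>1\<close>, generated by \<open>y \<mapsto> (2 x + y\<^sup>3) / 3\<close>. This is why the equation is
  solvable on the whole closed unit ball, including the vectors of norm exactly \<open>1\<close>.
\<close>

lemma cubic_preimage_exists:
  fixes x :: "'a::cstar_algebra"
  assumes "norm x \<le> 1"
  obtains y where "norm y \<le> 1" "3 *\<^sub>R y - y * star y * y = 2 *\<^sub>R x"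
proof -
  define y where "y = rec_nat 0 (\<lambda>_ z. (2 *\<^sub>R x + z * star z * z) /\<^sub>R 3)"
  have yS: "y 0 = 0" "y (Suc n) = (2 *\<^sub>R x + y n * star (y n) * y n) /\<^sub>R 3" for n
    by (simp_all add: y_def)
  define s :: "nat \<Rightarrow> real" where "s = rec_nat 0 (\<lambda>_ z. (2 + z * z * z) / 3)"
  have sS: "s 0 = 0" "s (Suc n) = (2 + s n * s n * s n) / 3" for n
    by (simp_all add: s_def)
  have s01: "0 \<le> s n \<and> s n \<le> 1" for n
    by (induction n) (auto simp: sS mult_le_one)
  obtain l where lim: "y \<longlonglongrightarrow> l" and l1: "norm l \<le> 1"
  proof (rule majorised_iteration[of y s])
    show "norm (y 1) \<le> s 1" using assms yS(2)[of 0] sS(2)[of 0] by (simp add: yS(1) sS(1))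
  next
    fix n assume n: "norm (y n) \<le> s n" "norm (y (Suc n)) \<le> s (Suc n)"
      "norm (y (Suc n) - y n) \<le> s (Suc n) - s n"
    let ?a = "y (Suc n)" and ?b = "y n" and ?s = "s (Suc n)" and ?r = "s n"
    have "y (Suc (Suc n)) - y (Suc n) = (?a * star ?a * ?a - ?b * star ?b * ?b) /\<^sub>R 3"
      by (subst yS(2)[of "Suc n"], subst (4) yS(2)[of n]) (simp add: algebra_simps)
    also have "?a * star ?a * ?a - ?b * star ?b * ?b =
        (?a - ?b) * star ?a * ?a + ?b * star (?a - ?b) * ?a + ?b * star ?b * (?a - ?b)"
      by (simp add: algebra_simps star_simps)
    finally have "norm (y (Suc (Suc n)) - y (Suc n)) = 
      norm ((?a - ?b) * star ?a * ?a + ?b * star (?a - ?b) * ?a + ?b * star ?b * (?a - ?b)) / 3"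
      by simp
    also have "\<dots> \<le> ((?s - ?r) * ?s * ?s + ?r * (?s - ?r) * ?s + ?r * ?r * (?s - ?r)) / 3"
    proof (intro divide_right_mono norm_triangle_le add_mono)
      have m: "norm (u * star v * w) \<le> u' * v' * w'"
        if "norm u \<le> u'" "norm v \<le> v'" "norm w \<le> w'" for u v w :: 'a and u' v' w'
      proof -
        have "norm (u * star v * w) \<le> norm u * norm v * norm w"
          by (metis norm_mult_ineq norm_star mult_right_mono norm_ge_zero order_trans)
        also have "\<dots> \<le> u' * v' * w'"
          using that by (intro mult_mono) (auto intro: order_trans[OF norm_ge_zero] mult_nonneg_nonneg)
        finally show ?thesis .
      qed
      show "norm ((?a - ?b) * star ?a * ?a) \<le> (?s - ?r) * ?s * ?s"
        "norm (?b * star (?a - ?b) * ?a) \<le> ?r * (?s - ?r) * ?s"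
        "norm (?b * star ?b * (?a - ?b)) \<le> ?r * ?r * (?s - ?r)"
        using m n by blast+
    qed simp
    also have "\<dots> = s (Suc (Suc n)) - s (Suc n)"
    proof -
      have "(?s - ?r) * ?s * ?s + ?r * (?s - ?r) * ?s + ?r * ?r * (?s - ?r) = ?s * ?s * ?s - ?r * ?r * ?r"
        by (simp add: algebra_simps)
      moreover have "3 * s (Suc (Suc n)) = 2 + ?s * ?s * ?s" "3 * ?s = 2 + ?r * ?r * ?r"
        by (simp_all add: sS(2)[of "Suc n"]) (simp add: sS(2))
      ultimately show ?thesis by (simp only: divide_eq_eq) (simp add: algebra_simps)
    qed
    finally show "norm (y (Suc (Suc n)) - y (Suc n)) \<le> s (Suc (Suc n)) - s (Suc n)" .
  qed (use yS sS s01 in auto)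
  have "(\<lambda>n. y (Suc n)) \<longlonglongrightarrow> (2 *\<^sub>R x + l * star l * l) /\<^sub>R 3"
    unfolding yS by (intro tendsto_intros lim tendsto_star)
  moreover have "(\<lambda>n. y (Suc n)) \<longlonglongrightarrow> l" using lim by (rule LIMSEQ_Suc)
  ultimately have fix_eq: "l = (2 *\<^sub>R x + l * star l * l) /\<^sub>R 3" using LIMSEQ_unique by blast
  have "3 *\<^sub>R l = 2 *\<^sub>R x + l * star l * l"
    by (subst (1) fix_eq) simp
  then show thesis using that[of l] l1 by simp
qed

section \<open>Positivity in unital C*-algebras\<close>

lemma star_one [simp]: "star (1::'a::{cstar_algebra,monoid_mult}) = 1"
  by (metis mult_1_left mult_1_right star_mult star_star)

text \<open>
  Equality holds unless \<open>1 = 0\<close>. The trivial algebra is not excluded, since the multiplier algebra of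
  the zero algebra is zero.
\<close>

lemma norm_one_le: "norm (1::'a::{cstar_algebra,monoid_mult}) \<le> 1"
proof -
  have "(norm (1::'a))\<^sup>2 = norm (1::'a)" using cstar_identity[of "1::'a"] by simp
  then show ?thesis by (auto simp: power2_eq_square)
qed

lemma norm_scaleR_one_le: "norm (r *\<^sub>R (1::'a::{cstar_algebra,monoid_mult})) \<le> \<bar>r\<bar>"
  using mult_left_mono[OF norm_one_le[where 'a='a], of "\<bar>r\<bar>"] by simp

lemma star_power: "star (h ^ n) = star (h::'a::{cstar_algebra,monoid_mult}) ^ n"
  by (induction n) (simp_all add: star_mult power_commutes)

lemma norm_selfadjoint_power:
  fixes h :: "'a::{cstar_algebra,monoid_mult}"
  assumes "star h = h"
  shows "norm (h ^ (2 ^ k)) = norm h ^ (2 ^ k)"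
proof (induction k)
  case (Suc k)
  have "h ^ (2 ^ Suc k) = h ^ (2 ^ k) * h ^ (2 ^ k)"
    by (simp add: power_add[symmetric] mult_2)
  moreover have "star (h ^ (2 ^ k)) = h ^ (2 ^ k)"
    by (simp add: star_power assms)
  ultimately have "norm (h ^ (2 ^ Suc k)) = (norm (h ^ (2 ^ k)))\<^sup>2"
    using norm_selfadjoint_square by metis
  then show ?case using Suc by (simp add: power_mult[symmetric] mult.commute)
qed simp

text \<open>
  With \<open>k = sin \<theta>\<close> and \<open>l = cos \<theta>\<close> a square root of \<open>1 - k\<^sup>2\<close> that commutes with \<open>k\<close>, the element
  \<open>U = l + i k\<close> is unitary and \<open>1 - 2 k\<^sup>2 = cos (2 \<theta>)\<close> is the real part of \<open>U\<^sup>2\<close>.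
\<close>

lemma norm_one_minus_two_squares:
  fixes k :: "'a::{cstar_algebra,monoid_mult}"
  assumes sa: "star k = k" and le: "norm k \<le> 1"
  shows "norm (1 - 2 *\<^sub>R (k * k)) \<le> 1"
proof -
  have "norm (k * k) \<le> 1"
    using norm_selfadjoint_square[OF sa] le by (simp add: power_le_one)
  then obtain m where m: "star m = m" "2 *\<^sub>R m - m * m = k * k"
    "\<And>c. c * (k * k) = (k * k) * c \<Longrightarrow> c * m = m * c"
    using sqrt_exists[of "k * k"] sa by (metis star_mult)
  have km: "k * m = m * k" using m(3)[of k] by (simp add: mult.assoc)
  define l where "l = 1 - m"
  have l: "star l = l" "l * k = k * l" "l * l = 1 - k * k"
    using m(1,2) km by (auto simp: l_def star_simps algebra_simps scaleR_2)
  define U where "U = l + \<i> *\<^sub>C k"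
  have sU: "star U = l - \<i> *\<^sub>C k"
    by (simp add: U_def star_simps l sa scaleC_minus_left)
  have UU: "star U * U = 1"
    unfolding sU by (simp add: U_def algebra_simps mult_scaleC_left mult_scaleC_right scaleC_scaleC
        scaleC_minus_one l scaleC_diff_right scaleC_add_right)
  have eq: "U * U + star U * star U = 2 *\<^sub>R (1 - 2 *\<^sub>R (k * k))"
    unfolding sU by (simp add: U_def algebra_simps mult_scaleC_left mult_scaleC_right scaleC_scaleC
        scaleC_minus_one l scaleC_diff_right scaleC_add_right scaleR_2)
  have "(norm U)\<^sup>2 \<le> 1"
    using cstar_identity[of U] norm_one_le[where 'a='a] by (simp add: UU)
  then have U1: "norm U * norm U \<le> 1" by (simp add: power2_eq_square)
  have "norm (U * U + star U * star U) \<le> norm U * norm U + norm U * norm U"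
    using norm_triangle_ineq[of "U * U" "star U * star U"] norm_mult_ineq[of U U]
      norm_mult_ineq[of "star U" "star U"] by simp
  then show ?thesis using U1 unfolding eq by simp
qed

text \<open>
  Positivity is taken to mean being the square of a selfadjoint element. The lemmas below translate
  this into a condition on norms (\<open>pos_iff\<close>), which makes the closure of the positive cone under
  sums evident.
\<close>

definition pos :: "'a::cstar_algebra \<Rightarrow> bool"
  where "pos h \<longleftrightarrow> (\<exists>k. star k = k \<and> h = k * k)"

lemma pos_selfadjoint: "pos h \<Longrightarrow> star h = h"
  by (auto simp: pos_def star_mult)

lemma pos_norm_diff_le:
  fixes h :: "'a::{cstar_algebra,monoid_mult}"
  assumes "pos h" "norm h \<le> 2 * M"
  shows "norm (M *\<^sub>R 1 - h) \<le> M"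
proof (cases "M = 0")
  case True
  then show ?thesis using assms by simp
next
  case False
  with assms have M: "M > 0" using norm_ge_zero[of h] by linarith
  obtain k where k: "star k = k" "h = k * k" using assms by (auto simp: pos_def)
  define c where "c = (1 / sqrt (2 * M)) *\<^sub>R k"
  have cc: "c * c = (1 / (2 * M)) *\<^sub>R h" using M by (simp add: c_def k)
  have sc: "star c = c" by (simp add: c_def star_scaleR k)
  have "norm (c * c) \<le> 1" using M assms unfolding cc by (simp add: field_simps)
  then have "norm c \<le> 1"
    using norm_selfadjoint_square[OF sc] by (simp add: abs_square_le_1)
  from norm_one_minus_two_squares[OF sc this]
  have "norm (1 - (1 / M) *\<^sub>R h) \<le> 1" unfolding cc by simp
  then have "M * norm (1 - (1 / M) *\<^sub>R h) \<le> M" using M by simp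
  moreover have "M *\<^sub>R 1 - h = M *\<^sub>R (1 - (1 / M) *\<^sub>R h)"
    using M by (simp add: algebra_simps)
  ultimately show ?thesis using M by simp
qed

text \<open>
  If \<open>\<parallel>M - h\<parallel> \<le> M\<close>, then \<open>h / M = 1 - p\<close> with \<open>\<parallel>p\<parallel> \<le> 1\<close>, and \<open>1 - p\<close> has a square root.
\<close>

lemma pos_if_norm_diff_le:
  fixes h :: "'a::{cstar_algebra,monoid_mult}"
  assumes sa: "star h = h" and le: "norm (M *\<^sub>R 1 - h) \<le> M"
  obtains k where "star k = k" "h = k * k" "\<And>c. c * h = h * c \<Longrightarrow> c * k = k * c"
proof (cases "M = 0")
  case True
  then show ?thesis using le that[of 0] by simp
next
  case False
  with le have M: "M > 0" using norm_ge_zero[of "M *\<^sub>R 1 - h"] by linarith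
  define p where "p = 1 - (1 / M) *\<^sub>R h"
  have Mp: "M *\<^sub>R 1 - h = M *\<^sub>R p" using M by (simp add: p_def algebra_simps)
  have "star p = p" by (simp add: p_def star_simps sa)
  moreover have "norm p \<le> 1" using le M unfolding Mp by simp
  ultimately obtain m where m: "star m = m" "2 *\<^sub>R m - m * m = p"
    "\<And>c. c * p = p * c \<Longrightarrow> c * m = m * c"
    using sqrt_exists by metis
  define k where "k = sqrt M *\<^sub>R (1 - m)"
  have "k * k = M *\<^sub>R (1 - p)" using M by (simp add: k_def m(2)[symmetric] algebra_simps scaleR_2)
  also have "\<dots> = h" using M by (simp add: p_def)
  finally have "h = k * k" by simp
  moreover have "star k = k" by (simp add: k_def star_simps m(1))
  moreover have "c * k = k * c" if "c * h = h * c" for c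
    using m(3)[of c] that by (simp add: k_def p_def algebra_simps)
  ultimately show ?thesis using that by blast
qed

lemma pos_iff:
  fixes h :: "'a::{cstar_algebra,monoid_mult}"
  assumes "norm h \<le> 2 * M"
  shows "pos h \<longleftrightarrow> star h = h \<and> norm (M *\<^sub>R 1 - h) \<le> M"
  using assms pos_norm_diff_le pos_selfadjoint pos_if_norm_diff_le unfolding pos_def by metis

lemma pos_add:
  fixes a b :: "'a::{cstar_algebra,monoid_mult}"
  assumes "pos a" "pos b"
  shows "pos (a + b)"
proof -
  have "norm ((norm a + norm b) *\<^sub>R 1 - (a + b))
      = norm ((norm a *\<^sub>R 1 - a) + (norm b *\<^sub>R 1 - b))"
    by (simp add: algebra_simps)
  also have "\<dots> \<le> norm a + norm b"
    using pos_norm_diff_le[OF assms(1), of "norm a"] pos_norm_diff_le[OF assms(2), of "norm b"]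
    by (intro norm_triangle_le add_mono) auto
  finally show ?thesis
    using assms pos_if_norm_diff_le[of "a + b"] pos_selfadjoint unfolding pos_def
    by (metis star_add)
qed

text \<open>
  Taking \<open>M = \<parallel>h\<parallel> / 2\<close>, the smallest value permitted in \<open>pos_norm_diff_le\<close>, is what makes the two
  estimates for \<open>h\<close> and \<open>- h\<close> incompatible with \<open>h \<noteq> 0\<close>.
\<close>

lemma pos_antisym:
  fixes h :: "'a::{cstar_algebra,monoid_mult}"
  assumes "pos h" "pos (- h)"
  shows "h = 0"
proof -
  let ?M = "norm h / 2"
  have "norm (?M *\<^sub>R 1 - (- h)) \<le> ?M" "norm (?M *\<^sub>R 1 - h) \<le> ?M"
    using pos_norm_diff_le[OF assms(1), of ?M] pos_norm_diff_le[OF assms(2), of ?M] by simp_all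
  then have "norm ((?M *\<^sub>R 1 - (- h)) - (?M *\<^sub>R 1 - h)) \<le> ?M + ?M"
    by (rule norm_triangle_le_diff[OF add_mono])
  moreover have "(?M *\<^sub>R 1 - (- h)) - (?M *\<^sub>R 1 - h) = 2 *\<^sub>R h" by (simp add: scaleR_2)
  ultimately show ?thesis by simp
qed

text \<open>
  The linear factor \<open>1 + 2\<^sup>k C\<close> is negligible against the growth of \<open>2\<^sup>k\<close>-th powers.
\<close>

lemma linear_bound_of_powers:
  fixes x K C :: real
  assumes x: "0 \<le> x" and K: "0 < K"
    and bound: "\<And>k. x ^ (2 ^ k) \<le> K ^ (2 ^ k) * (1 + 2 ^ k * C)"
  shows "x \<le> K"
proof (rule ccontr)
  assume "\<not> x \<le> K"
  define r where "r = K / x"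
  have r: "0 < r" "r < 1" and x0: "x > 0" using \<open>\<not> x \<le> K\<close> K by (auto simp: r_def)
  have ge: "1 \<le> r ^ (2 ^ k) + C * (real (2 ^ k) * r ^ (2 ^ k))" for k
    using bound[of k] x0 by (simp add: r_def power_divide field_simps)
  have "(\<lambda>n. r ^ n + C * (real n * r ^ n)) \<longlonglongrightarrow> 0 + C * 0"
    using r by (intro tendsto_intros powser_times_n_limit_0 LIMSEQ_power_zero) auto
  then have "(\<lambda>k. r ^ (2 ^ k) + C * (real (2 ^ k) * r ^ (2 ^ k))) \<longlonglongrightarrow> 0"
    using LIMSEQ_subseq_LIMSEQ[of _ 0 "\<lambda>k. 2 ^ k"] by (force simp: strict_mono_def o_def)
  then have "1 \<le> (0::real)" by (rule LIMSEQ_le_const) (use ge in blast)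
  then show False by simp
qed

text \<open>
  This replaces the fact that \<open>w\<^sup>* w\<close> and \<open>w w\<^sup>*\<close> have the same spectrum up to \<open>0\<close>. The powers of
  \<open>M - w\<^sup>* w\<close> are \<open>M\<^sup>n + w\<^sup>* c w\<close> with \<open>c\<close> built from powers of \<open>M - w w\<^sup>*\<close>, which bounds them by \<open>K\<^sup>n\<close> up
  to a factor linear in \<open>n\<close>; as \<open>M - w\<^sup>* w\<close> is selfadjoint, its norm is determined by its powers.
\<close>

lemma norm_shift_star_swap:
  fixes w :: "'a::{cstar_algebra,monoid_mult}"
  assumes K: "0 < K" and MK: "\<bar>M\<bar> \<le> K" and wK: "norm (M *\<^sub>R 1 - w * star w) \<le> K"
  shows "norm (M *\<^sub>R 1 - star w * w) \<le> K"
proof -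
  let ?h = "M *\<^sub>R 1 - star w * w"
  have main: "\<exists>c. ?h ^ n = (M ^ n) *\<^sub>R 1 + star w * c * w \<and> K * norm c \<le> n * K ^ n" for n
  proof (induction n)
    case 0
    then show ?case by (intro exI[of _ 0]) simp
  next
    case (Suc n)
    then obtain c where c: "?h ^ n = (M ^ n) *\<^sub>R 1 + star w * c * w" "K * norm c \<le> n * K ^ n"
      by blast
    let ?d = "(M *\<^sub>R 1 - w * star w) * c - (M ^ n) *\<^sub>R 1"
    have "?h ^ Suc n = ?h * ((M ^ n) *\<^sub>R 1 + star w * c * w)" by (simp add: c)
    also have "\<dots> = (M ^ Suc n) *\<^sub>R 1 + star w * ?d * w"
      by (simp add: algebra_simps)
    finally have 1: "?h ^ Suc n = (M ^ Suc n) *\<^sub>R 1 + star w * ?d * w" .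
    have "norm ?d \<le> norm (M *\<^sub>R 1 - w * star w) * norm c + \<bar>M ^ n\<bar>"
      by (intro norm_triangle_le_diff add_mono norm_mult_ineq norm_scaleR_one_le)
    also have "\<dots> \<le> K * norm c + K ^ n"
      using wK MK by (intro add_mono mult_right_mono) (auto simp: power_abs intro: power_mono)
    also have "\<dots> \<le> n * K ^ n + K ^ n" using c by simp
    finally have "K * norm ?d \<le> K * (n * K ^ n + K ^ n)" using K by simp
    then have "K * norm ?d \<le> Suc n * K ^ Suc n" by (simp add: algebra_simps)
    with 1 show ?case by blast
  qed
  have sa: "star ?h = ?h" by (simp add: star_simps)
  show ?thesis
  proof (rule linear_bound_of_powers[of _ K "norm w * norm w / K"])
    fix k :: nat
    let ?n = "2 ^ k :: nat"
    obtain c where c: "?h ^ ?n = (M ^ ?n) *\<^sub>R 1 + star w * c * w" "K * norm c \<le> ?n * K ^ ?n"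
      using main[of ?n] by blast
    have "norm (star w * c * w) \<le> norm w * norm c * norm w"
      by (metis norm_mult_ineq norm_star mult_right_mono norm_ge_zero order_trans)
    moreover have "norm c \<le> ?n * K ^ ?n / K" using c(2) K by (simp add: field_simps)
    ultimately have 2: "norm (star w * c * w) \<le> norm w * (?n * K ^ ?n / K) * norm w"
      by (smt (verit) mult_left_mono mult_right_mono norm_ge_zero)
    have "norm ?h ^ ?n = norm (?h ^ ?n)" by (rule norm_selfadjoint_power[OF sa, symmetric])
    also have "\<dots> \<le> \<bar>M ^ ?n\<bar> + norm (star w * c * w)"
      unfolding c(1) by (intro norm_triangle_le add_mono norm_scaleR_one_le) simp
    also have "\<bar>M ^ ?n\<bar> \<le> K ^ ?n" using MK by (simp add: power_abs power_mono)
    finally have "norm ?h ^ ?n \<le> K ^ ?n + norm w * (?n * K ^ ?n / K) * norm w" using 2 by simp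
    also have "\<dots> = K ^ ?n * (1 + 2 ^ k * (norm w * norm w / K))" using K by (simp add: field_simps)
    finally show "norm ?h ^ ?n \<le> K ^ ?n * (1 + 2 ^ k * (norm w * norm w / K))" .
  qed (use K in auto)
qed

lemma neg_star_mult_swap:
  fixes w :: "'a::{cstar_algebra,monoid_mult}"
  assumes "pos (- (w * star w))"
  shows "pos (- (star w * w))"
proof (cases "w = 0")
  case False
  let ?M = "(norm w)\<^sup>2"
  have flip: "(- r) *\<^sub>R 1 - x = - (r *\<^sub>R 1 - (- x))" for r and x :: 'a
    by (simp add: algebra_simps)
  have "norm (?M *\<^sub>R 1 - (- (w * star w))) \<le> ?M"
    using assms by (intro pos_norm_diff_le) (auto simp: cstar_identity')
  then have "norm ((- ?M) *\<^sub>R 1 - w * star w) \<le> ?M"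
    by (simp only: flip norm_minus_cancel)
  then have "norm ((- ?M) *\<^sub>R 1 - star w * w) \<le> ?M"
    using False by (intro norm_shift_star_swap) auto
  then have "norm (?M *\<^sub>R 1 - (- (star w * w))) \<le> ?M"
    by (simp only: flip norm_minus_cancel)
  then show ?thesis
    using pos_iff[of "- (star w * w)" ?M] by (simp add: cstar_identity star_simps)
qed (use assms in simp)

text \<open>
  In terms of the real and imaginary parts of \<open>w = a + i b\<close> one has \<open>w\<^sup>* w + w w\<^sup>* = 2 a\<^sup>2 + 2 b\<^sup>2\<close>. If
  \<open>- w\<^sup>* w\<close> is positive, then so is \<open>- w w\<^sup>*\<close>, and therefore \<open>w\<^sup>* w\<close> is positive as well.
\<close>

lemma neg_star_mult_zero:
  fixes w :: "'a::{cstar_algebra,monoid_mult}"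
  assumes neg: "pos (- (star w * w))"
  shows "w = 0"
proof -
  define a where "a = (1 / 2) *\<^sub>R (w + star w)"
  define b where "b = (1 / 2) *\<^sub>R (\<i> *\<^sub>C (star w - w))"
  have "star a = a" by (simp add: a_def star_simps add.commute)
  moreover have "star b = b"
    by (simp add: b_def star_simps scaleC_diff_right scaleC_minus_left)
  ultimately have p: "pos (a * a)" "pos (b * b)" by (auto simp: pos_def)
  let ?X = "(w + star w) * (w + star w)" and ?Y = "(star w - w) * (star w - w)"
  have "a * a + a * a = (1 / 2) *\<^sub>R ?X"
    by (simp add: a_def scaleR_add_left[symmetric] del: scaleR_add_right)
  moreover have "b * b + b * b = - ((1 / 2) *\<^sub>R ?Y)"
  proof -
    have "b * b = - ((1 / 4) *\<^sub>R ?Y)"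
      by (simp add: b_def mult_scaleC_left mult_scaleC_right scaleC_scaleC scaleC_minus_one scaleC_scaleR)
    moreover have "(1 / 4) *\<^sub>R y + (1 / 4) *\<^sub>R y = (1 / 2) *\<^sub>R y" for y :: 'a
      by (simp add: scaleR_add_left[symmetric])
    ultimately show ?thesis by (metis minus_add_distrib)
  qed
  ultimately have "a * a + a * a + b * b + b * b = (1 / 2) *\<^sub>R (?X - ?Y)"
    by (simp add: scaleR_diff_right add.assoc)
  also have "?X - ?Y = 2 *\<^sub>R (star w * w + w * star w)"
    by (simp add: algebra_simps scaleR_2)
  finally have "a * a + a * a + b * b + b * b = star w * w + w * star w" by simp
  then have eq: "star w * w = a * a + a * a + b * b + b * b + - (w * star w)" by simp
  have "pos (- (w * star w))"
    using neg_star_mult_swap[of "star w"] neg by (simp add: star_star)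
  then have "pos (star w * w)" unfolding eq by (intro pos_add p)
  then have "star w * w = 0" using neg pos_antisym by blast
  then show ?thesis using cstar_identity[of w] by simp
qed

text \<open>
  Let \<open>h = v\<^sup>* v\<close> and let \<open>A = \<bar>h\<bar>\<close> be the positive square root of \<open>h\<^sup>2\<close>. Cutting \<open>v\<close> down to the
  negative part \<open>u = A - h\<close> (twice the usual one) yields \<open>w = v u\<close> with \<open>w\<^sup>* w = - A u\<^sup>2\<close> negative. So
  \<open>w = 0\<close>, which forces \<open>u = 0\<close> and \<open>h = A\<close>.
\<close>

lemma pos_star_mult_contraction:
  fixes v :: "'a::{cstar_algebra,monoid_mult}"
  assumes "norm v \<le> 1"
  shows "pos (star v * v)"
proof -
  define h where "h = star v * v"
  have sh: "star h = h" by (simp add: h_def star_simps)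
  have h1: "norm h \<le> 1" using assms by (simp add: h_def cstar_identity power_le_one)
  have "norm (1 *\<^sub>R 1 - h * h) \<le> 1"
  proof (rule pos_norm_diff_le)
    show "pos (h * h)" using sh by (auto simp: pos_def)
    show "norm (h * h) \<le> 2 * 1" using norm_selfadjoint_square[OF sh] h1 by (simp add: abs_square_le_1 power_le_one order_trans[of _ 1])
  qed
  then have n1: "norm (1 - h * h) \<le> 1" by simp
  have s1: "star (1 - h * h) = 1 - h * h" by (simp add: star_simps sh)
  obtain m where m: "star m = m" "norm m \<le> 1" "2 *\<^sub>R m - m * m = 1 - h * h"
    "\<And>c. c * (1 - h * h) = (1 - h * h) * c \<Longrightarrow> c * m = m * c"
    using sqrt_exists[OF s1 n1] by metis
  define A where "A = 1 - m"
  have "h * m = m * h" using m(4)[of h] by (simp add: algebra_simps)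
  then have Ah: "h * A = A * h" by (simp add: A_def algebra_simps)
  have AA: "A * A = h * h"
  proof -
    have "A * A = 1 - (2 *\<^sub>R m - m * m)" by (simp add: A_def algebra_simps scaleR_2)
    then show ?thesis by (simp add: m(3))
  qed
  have sA: "star A = A" by (simp add: A_def star_simps m(1))
  have "norm (1 *\<^sub>R 1 - A) \<le> 1" by (simp add: A_def m(2))
  then obtain k where k: "star k = k" "A = k * k" "\<And>c. c * A = A * c \<Longrightarrow> c * k = k * c"
    using pos_if_norm_diff_le[OF sA] by blast
  define u where "u = A - h"
  have hu: "h * u = - (A * u)" using AA by (simp add: u_def algebra_simps Ah)
  have uA: "u * A = A * u" by (simp add: u_def algebra_simps Ah)
  have uk: "u * k = k * u" using k(3)[OF uA] .
  have su: "star u = u" by (simp add: u_def star_simps sh sA)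
  define w where "w = v * u"
  have "star w * w = u * (h * u)" by (simp add: w_def star_simps su h_def mult.assoc)
  also have "\<dots> = - ((k * u) * (k * u))" using uk by (simp add: hu k(2)) (metis mult.assoc)
  finally have ww: "star w * w = - ((k * u) * (k * u))" .
  have "star (k * u) = k * u" by (simp add: star_simps su k uk)
  then have "pos (- (star w * w))" unfolding ww pos_def by auto
  then have "w = 0" by (rule neg_star_mult_zero)
  then have "h * u = 0" by (simp add: h_def w_def mult.assoc)
  then have Au: "A * u = 0" using hu by simp
  have "u * u = A * u - h * u" by (simp add: u_def algebra_simps)
  then have "u * u = 0" using Au \<open>h * u = 0\<close> by simp
  then have "u = 0" using norm_selfadjoint_square[OF su] by simp
  then have "h = A" by (simp add: u_def)
  then show ?thesis using k unfolding h_def[symmetric] pos_def by blast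
qed

text \<open>
  In spectral terms, \<open>v\<^sup>* v\<close> has its spectrum in \<open>[0, 2]\<close>.
\<close>

theorem norm_one_minus_star_mult_le:
  fixes v :: "'a::{cstar_algebra,monoid_mult}"
  assumes "(norm v)\<^sup>2 \<le> 2"
  shows "norm (1 - star v * v) \<le> 1"
proof -
  define c where "c = (1 / sqrt 2) *\<^sub>R v"
  have "norm c \<le> 1" using assms real_le_rsqrt[of "norm v" 2] by (simp add: c_def field_simps)
  then have "pos (star c * c)" by (rule pos_star_mult_contraction)
  then obtain k where k: "star k = k" "star c * c = k * k" by (auto simp: pos_def)
  have "star c * c = (1 / 2) *\<^sub>R (star v * v)" by (simp add: c_def star_simps)
  with k have "star v * v = 2 *\<^sub>R (k * k)" by (metis scaleR_half_double scaleR_2 scaleR_add_right)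
  moreover have "norm k \<le> 1"
  proof -
    have "(norm k)\<^sup>2 = (norm c)\<^sup>2" using norm_selfadjoint_square[OF k(1)] k(2) cstar_identity[of c] by simp
    then show ?thesis using \<open>norm c \<le> 1\<close> by (simp add: power2_eq_iff_nonneg)
  qed
  ultimately show ?thesis using norm_one_minus_two_squares[OF k(1)] by simp
qed

section \<open>Norm estimates in unital C*-algebras\<close>

lemma norm_mult3_le:
  fixes u v w :: "'a::cstar_algebra"
  shows "norm (u * v * w) \<le> norm u * norm v * norm w"
  by (metis norm_mult_ineq mult_right_mono norm_ge_zero order_trans)

text \<open>
  With \<open>p = v\<^sup>* v\<close> and \<open>F = 3 v - v v\<^sup>* v\<close> the identity \<open>4 - p (3 - p)\<^sup>2 = (1 - p)\<^sup>2 (4 - p)\<close> gives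
  \<open>F\<^sup>* F = 4 (1 - k\<^sup>2)\<close> with \<open>k = (1 - p) l\<close> and \<open>l\<^sup>2 = 1 - p / 4\<close>.
\<close>

lemma cubic_norm_le_unital:
  fixes v :: "'a::{cstar_algebra,monoid_mult}"
  assumes "(norm v)\<^sup>2 \<le> 2"
  shows "norm (3 *\<^sub>R v - v * star v * v) \<le> 2"
proof -
  define p where "p = star v * v"
  have sp: "star p = p" by (simp add: p_def star_simps)
  have p1: "norm (1 - p) \<le> 1"
    unfolding p_def by (rule norm_one_minus_star_mult_le[OF assms])
  define q where "q = 1 - (1 / 4) *\<^sub>R p"
  have sq: "star q = q" by (simp add: q_def star_simps sp)
  have p2: "norm p \<le> 2" using assms by (simp add: p_def cstar_identity)
  have "norm (1 *\<^sub>R 1 - q) \<le> 1" using p2 by (simp add: q_def)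
  then obtain l where l: "star l = l" "q = l * l" "\<And>c. c * q = q * c \<Longrightarrow> c * l = l * c"
    using pos_if_norm_diff_le[OF sq] by metis
  have q1: "norm q \<le> 1"
  proof -
    have "(3 / 4) *\<^sub>R 1 + (1 / 4) *\<^sub>R 1 = (1 :: 'a)"
      by (simp add: scaleR_add_left[symmetric])
    then have eq: "q = (3 / 4) *\<^sub>R 1 + (1 / 4) *\<^sub>R (1 - p)"
      unfolding q_def scaleR_diff_right by (metis add_diff_eq)
    have "norm ((3 / 4) *\<^sub>R (1 :: 'a)) \<le> 3 / 4"
      using norm_scaleR_one_le[of "3/4", where 'a='a] by simp
    moreover have "norm ((1 / 4) *\<^sub>R (1 - p)) \<le> 1 / 4" using p1 by simp
    ultimately show ?thesis unfolding eq
      using norm_triangle_ineq[of "(3 / 4) *\<^sub>R 1" "(1 / 4) *\<^sub>R (1 - p)"] by linarith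
  qed
  have pl: "p * l = l * p" by (rule l(3)) (simp add: q_def algebra_simps)
  define r where "r = 1 - p"
  have rl: "r * l = l * r" by (simp add: r_def algebra_simps pl)
  define k where "k = r * l"
  have sr: "star r = r" by (simp add: r_def star_simps sp)
  have sk: "star k = k" by (simp add: k_def star_mult sr l(1) rl)
  have kk: "k * k = r * q * r"
    unfolding k_def l(2) using rl by (metis mult.assoc)
  let ?F = "3 *\<^sub>R v - v * star v * v"
  have "star ?F * ?F = (3 *\<^sub>R 1 - p) * p * (3 *\<^sub>R 1 - p)"
    by (simp add: star_simps p_def algebra_simps)
  also have "\<dots> = 9 *\<^sub>R p - 6 *\<^sub>R (p * p) + p * p * p"
    by (simp add: algebra_simps scaleR_add_left[symmetric])
  also have "\<dots> = 4 *\<^sub>R 1 - r * (4 *\<^sub>R 1 - p) * r"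
    using scaleR_left_distrib[of 1 8 p] scaleR_left_distrib[of 4 4 p]
      scaleR_left_distrib[of 2 4 "p * p"]
    by (simp add: r_def algebra_simps scaleR_2)
  also have "4 *\<^sub>R 1 - p = 4 *\<^sub>R q"
    by (simp add: q_def scaleR_diff_right)
  also have "4 *\<^sub>R 1 - r * (4 *\<^sub>R q) * r = 4 *\<^sub>R (1 - k * k)"
    by (simp add: kk scaleR_diff_right)
  finally have FF: "star ?F * ?F = 4 *\<^sub>R (1 - k * k)" .
  have "norm (k * k) \<le> norm r * norm q * norm r"
    unfolding kk by (rule norm_mult3_le)
  also have "\<dots> \<le> 1 * 1 * 1" using p1 q1 unfolding r_def by (intro mult_mono) auto
  finally have "(norm k)\<^sup>2 \<le> 2" using norm_selfadjoint_square[OF sk] by simp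
  from norm_one_minus_star_mult_le[OF this] have "norm (1 - k * k) \<le> 1" by (simp add: sk)
  then have "(norm ?F)\<^sup>2 \<le> 2\<^sup>2" unfolding cstar_identity[symmetric] FF by simp
  then show ?thesis by (rule power2_le_imp_le) simp
qed

text \<open>
  Set \<open>d = (1 - z\<^sup>* z)\<^sup>1\<^sup>/\<^sup>2\<close> and \<open>b = 1 - t a\<^sup>* z\<close>. Up to a term of order \<open>t\<^sup>2\<close>, the square of the absolute
  value of the vector on the left is \<open>1 - (d b)\<^sup>* (d b)\<close>, so that positivity of \<open>(d b)\<^sup>* (d b)\<close> bounds
  it by \<open>1\<close>. The constant \<open>2 / 5\<close> ensures \<open>\<parallel>d b\<parallel>\<^sup>2 \<le> (7 / 5)\<^sup>2 < 2\<close>.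
\<close>

lemma tangent_norm_le_unital:
  fixes z a :: "'a::{cstar_algebra,monoid_mult}"
  assumes z: "norm z \<le> 1" and ta: "\<bar>t\<bar> * norm a \<le> 2 / 5"
  shows "(norm (z + t *\<^sub>R (a - z * star a * z)))\<^sup>2 \<le> 1 + 5 * t\<^sup>2 * (norm a)\<^sup>2"
proof -
  define p where "p = star z * z"
  have sp: "star p = p" by (simp add: p_def star_simps)
  have zz: "(norm z)\<^sup>2 \<le> 1" using z by (simp add: power_le_one)
  have p1: "norm (1 - p) \<le> 1"
    unfolding p_def by (rule norm_one_minus_star_mult_le) (use zz in simp)
  have np: "norm p \<le> 1" using zz by (simp add: p_def cstar_identity)
  have s1p: "star (1 - p) = 1 - p" by (simp add: star_simps sp)
  have "norm (1 *\<^sub>R 1 - (1 - p)) \<le> 1" using np by simp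
  then obtain d where d: "star d = d" "1 - p = d * d"
    using pos_if_norm_diff_le[OF s1p] by metis
  define b where "b = 1 - t *\<^sub>R (star a * z)"
  define e where "e = a - z * star a * z"
  let ?w = "z + t *\<^sub>R e"
  define r where "r = star e * e + star z * a * (1 - p) * (star a * z)"
  have az: "norm (star a * z) \<le> norm a"
    using norm_mult_ineq[of "star a" z] mult_left_mono[OF z, of "norm a"] by simp
  have za: "norm (star z * a) \<le> norm a"
    using norm_mult_ineq[of "star z" a] mult_right_mono[OF z, of "norm a"] by simp
  have ww: "star ?w * ?w = (1 - star (d * b) * (d * b)) + t\<^sup>2 *\<^sub>R r"
  proof -
    have "star (d * b) * (d * b) = star b * (1 - p) * b" by (simp add: star_mult d mult.assoc)
    then show ?thesis
      by (simp add: b_def r_def e_def p_def star_simps algebra_simps power2_eq_square)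
  qed
  have "(norm (d * b))\<^sup>2 \<le> 2"
  proof -
    have "(norm d)\<^sup>2 \<le> 1" using norm_selfadjoint_square[OF d(1)] p1 d(2) by simp
    then have d1: "norm d \<le> 1" by (simp add: abs_square_le_1)
    have "norm (t *\<^sub>R (star a * z)) \<le> 2 / 5"
      using mult_left_mono[OF az, of "\<bar>t\<bar>"] ta by simp
    then have b1: "norm b \<le> 7 / 5"
      using norm_triangle_ineq4[of 1 "t *\<^sub>R (star a * z)"] norm_one_le[where 'a='a] unfolding b_def by linarith
    have "norm (d * b) \<le> 1 * (7 / 5)"
      by (rule order_trans[OF norm_mult_ineq mult_mono[OF d1 b1]]) auto
    then have "(norm (d * b))\<^sup>2 \<le> (7 / 5)\<^sup>2" by (intro power_mono) auto
    then show ?thesis by (simp add: power2_eq_square)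
  qed
  from norm_one_minus_star_mult_le[OF this] have 1: "norm (1 - star (d * b) * (d * b)) \<le> 1" .
  have "norm r \<le> 5 * (norm a)\<^sup>2"
  proof -
    have "norm (z * star a * z) \<le> norm z * norm a * norm z"
      using norm_mult3_le[of z "star a" z] by simp
    also have "\<dots> \<le> 1 * norm a * 1"
      using z by (intro mult_mono) auto
    finally have "norm e \<le> 2 * norm a"
      using norm_triangle_ineq4[of a "z * star a * z"] by (simp add: e_def)
    then have "(norm e)\<^sup>2 \<le> (2 * norm a)\<^sup>2" by (intro power_mono) auto
    then have e2: "norm (star e * e) \<le> 4 * (norm a)\<^sup>2" by (simp add: cstar_identity power_mult_distrib)
    have "norm (star z * a * (1 - p) * (star a * z)) \<le> norm (star z * a) * norm (1 - p) * norm (star a * z)"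
      by (rule norm_mult3_le)
    also have "\<dots> \<le> norm a * 1 * norm a" using az za p1 by (intro mult_mono) auto
    finally have "norm (star z * a * (1 - p) * (star a * z)) \<le> (norm a)\<^sup>2"
      by (simp add: power2_eq_square)
    then show ?thesis unfolding r_def 
      using e2 norm_triangle_ineq[of "star e * e" "star z * a * (1 - p) * (star a * z)"] by linarith
  qed
  then have "norm (t\<^sup>2 *\<^sub>R r) \<le> t\<^sup>2 * (5 * (norm a)\<^sup>2)" by (simp add: mult_left_mono)
  with 1 have "norm (star ?w * ?w) \<le> 1 + t\<^sup>2 * (5 * (norm a)\<^sup>2)"
    unfolding ww by (rule norm_triangle_le[OF add_mono])
  then show ?thesis by (simp add: cstar_identity e_def mult.commute mult.left_commute)
qed

section \<open>The multiplier algebra\<close>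

text \<open>
  A multiplier is a pair of bounded operators on the algebra that are adjoint to each other for the
  algebra-valued inner product \<open>\<langle>x, y\<rangle> = x\<^sup>* y\<close>. Keeping the adjoint as a component makes the
  involution the exchange of components; the second component is determined by the first, see
  \<open>multiplier_eqI\<close>.
\<close>

typedef (overloaded) 'a multiplier =
  "{p :: ('a::cstar_algebra \<Rightarrow>\<^sub>L 'a) \<times> ('a \<Rightarrow>\<^sub>L 'a).
     \<forall>x y. star (blinfun_apply (fst p) x) * y = star x * blinfun_apply (snd p) y}"
  by (rule exI[of _ "(0, 0)"]) simp

definition app :: "'a::cstar_algebra multiplier \<Rightarrow> 'a \<Rightarrow> 'a"
  where "app m = blinfun_apply (fst (Rep_multiplier m))"

definition adj :: "'a::cstar_algebra multiplier \<Rightarrow> 'a \<Rightarrow> 'a"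
  where "adj m = blinfun_apply (snd (Rep_multiplier m))"

lemma star_app_mult: "star (app m x) * y = star x * adj m y"
  using Rep_multiplier[of m] by (auto simp: app_def adj_def)

lemma star_mult_left_cancel:
  fixes y z :: "'a::cstar_algebra"
  assumes "\<And>x. star x * y = star x * z"
  shows "y = z"
proof -
  have "star (y - z) * (y - z) = 0" using assms[of "y - z"] by (simp add: right_diff_distrib)
  then show ?thesis using cstar_identity[of "y - z"] by simp
qed

lemma mult_star_adj: "star (adj m x) * y = star x * app m y"
proof -
  have "star (star x * app m y) = star (star (adj m x) * y)"
    using star_app_mult[of m y x] by (simp add: star_mult star_star)
  then show ?thesis by (metis star_star)
qed

lemma multiplier_eqI:
  assumes "\<And>x. app m x = app n x"
  shows "m = n"
proof -
  have "adj m y = adj n y" for y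
    by (rule star_mult_left_cancel) (metis star_app_mult assms)
  then have "Rep_multiplier m = Rep_multiplier n"
    using assms by (intro prod_eqI blinfun_eqI) (auto simp: app_def adj_def)
  then show ?thesis by (simp add: Rep_multiplier_inject)
qed

definition multiplier_of :: "('a::cstar_algebra \<Rightarrow> 'a) \<Rightarrow> ('a \<Rightarrow> 'a) \<Rightarrow> 'a multiplier"
  where "multiplier_of f g = Abs_multiplier (Blinfun f, Blinfun g)"

lemma multiplier_of:
  assumes "bounded_linear f" "bounded_linear g" "\<And>x y. star (f x) * y = star x * g y"
  shows "app (multiplier_of f g) = f" "adj (multiplier_of f g) = g"
proof -
  have "Rep_multiplier (multiplier_of f g) = (Blinfun f, Blinfun g)"
    unfolding multiplier_of_def using assms
    by (intro Abs_multiplier_inverse) (simp add: bounded_linear_Blinfun_apply)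
  then show "app (multiplier_of f g) = f" "adj (multiplier_of f g) = g"
    using assms by (simp_all add: app_def adj_def bounded_linear_Blinfun_apply)
qed

lemma bounded_linear_app: "bounded_linear (app m)"
  and bounded_linear_adj: "bounded_linear (adj m)"
  by (simp_all add: app_def adj_def blinfun.bounded_linear_right)

lemmas app_simps = linear_add[OF bounded_linear.linear[OF bounded_linear_app]]
  linear_diff[OF bounded_linear.linear[OF bounded_linear_app]]
  linear_neg[OF bounded_linear.linear[OF bounded_linear_app]]
  linear_scale[OF bounded_linear.linear[OF bounded_linear_app]]
  linear_0[OF bounded_linear.linear[OF bounded_linear_app]]

lemma app_scaleC: "app m (c *\<^sub>C x) = c *\<^sub>C app m x"
  by (rule star_mult_left_cancel) (simp add: mult_star_adj[symmetric] mult_scaleC_right)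

instantiation multiplier :: (cstar_algebra) real_normed_vector
begin

definition zero_multiplier :: "'a multiplier"
  where "0 = multiplier_of (\<lambda>_. 0) (\<lambda>_. 0)"
definition plus_multiplier :: "'a multiplier \<Rightarrow> 'a multiplier \<Rightarrow> 'a multiplier"
  where "m + n = multiplier_of (\<lambda>x. app m x + app n x) (\<lambda>x. adj m x + adj n x)"
definition minus_multiplier :: "'a multiplier \<Rightarrow> 'a multiplier \<Rightarrow> 'a multiplier"
  where "m - n = multiplier_of (\<lambda>x. app m x - app n x) (\<lambda>x. adj m x - adj n x)"
definition uminus_multiplier :: "'a multiplier \<Rightarrow> 'a multiplier"
  where "- m = multiplier_of (\<lambda>x. - app m x) (\<lambda>x. - adj m x)"
definition scaleR_multiplier :: "real \<Rightarrow> 'a multiplier \<Rightarrow> 'a multiplier"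
  where "r *\<^sub>R m = multiplier_of (\<lambda>x. r *\<^sub>R app m x) (\<lambda>x. r *\<^sub>R adj m x)"
definition norm_multiplier :: "'a multiplier \<Rightarrow> real"
  where "norm m = onorm (app m)"
definition sgn_multiplier :: "'a multiplier \<Rightarrow> 'a multiplier"
  where "sgn_multiplier m = scaleR (inverse (norm m)) m"
definition dist_multiplier :: "'a multiplier \<Rightarrow> 'a multiplier \<Rightarrow> real"
  where "dist_multiplier m n = norm (m - n)"
definition uniformity_multiplier :: "('a multiplier \<times> 'a multiplier) filter"
  where "uniformity_multiplier = (INF e\<in>{0<..}. principal {(m :: 'a multiplier, n). dist m n < e})"
definition open_multiplier :: "'a multiplier set \<Rightarrow> bool"
  where "open_multiplier U \<longleftrightarrow> (\<forall>x\<in>U. eventually (\<lambda>(x', y). x' = x \<longrightarrow> y \<in> U) uniformity)"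

lemma multiplier_vector_simps:
  fixes m n :: "'a multiplier"
  shows "app (0::'a multiplier) x = 0"
    and "app (m + n) x = app m x + app n x"
    and "app (m - n) x = app m x - app n x"
    and "app (- m) x = - app m x"
    and "app (r *\<^sub>R m) x = r *\<^sub>R app m x"
    and "adj (m + n) x = adj m x + adj n x"
    and "adj (m - n) x = adj m x - adj n x"
proof -
  note bl = bounded_linear_app bounded_linear_adj bounded_linear_add bounded_linear_sub
    bounded_linear_minus bounded_linear_zero
    bounded_linear_compose[OF bounded_linear_scaleR_right bounded_linear_app]
    bounded_linear_compose[OF bounded_linear_scaleR_right bounded_linear_adj]
  note st = star_simps star_app_mult distrib_left distrib_right left_diff_distrib right_diff_distrib
  show "app (0::'a multiplier) x = 0" by (simp add: zero_multiplier_def multiplier_of bl)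
  show "app (m + n) x = app m x + app n x" "adj (m + n) x = adj m x + adj n x"
    by (simp_all add: plus_multiplier_def multiplier_of bl st)
  show "app (m - n) x = app m x - app n x" "adj (m - n) x = adj m x - adj n x"
    by (simp_all add: minus_multiplier_def multiplier_of bl st)
  show "app (- m) x = - app m x" by (simp add: uminus_multiplier_def multiplier_of bl st)
  show "app (r *\<^sub>R m) x = r *\<^sub>R app m x" by (simp add: scaleR_multiplier_def multiplier_of bl st)
qed

lemma norm_app_le: "norm (app m x) \<le> norm m * norm (x::'a)"
  unfolding norm_multiplier_def by (rule onorm[OF bounded_linear_app])

lemma norm_multiplier_le:
  assumes "0 \<le> K" "\<And>x::'a. norm (app m x) \<le> K * norm x"
  shows "norm m \<le> K"
  unfolding norm_multiplier_def using assms by (rule onorm_bound)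

lemma norm_multiplier_ge_zero: "0 \<le> norm (m :: 'a multiplier)"
  unfolding norm_multiplier_def by (rule onorm_pos_le[OF bounded_linear_app])

text \<open>
  Only one half of the equality \<open>\<parallel>m\<^sup>*\<parallel> = \<parallel>m\<parallel>\<close>, which suffices for completeness and for the C*-identity.
\<close>

lemma norm_adj_le: "norm (adj m x) \<le> norm m * norm (x::'a)"
proof (cases "adj m x = 0")
  case True
  then show ?thesis using norm_multiplier_ge_zero[of m] by simp
next
  case False
  have "(norm (adj m x))\<^sup>2 = norm (star (app m (adj m x)) * x)"
    by (simp add: star_app_mult cstar_identity)
  also have "\<dots> \<le> norm m * norm (adj m x) * norm x"
    using norm_mult_ineq[of "star (app m (adj m x))" x] norm_app_le[of m "adj m x"]
    by (smt (verit) mult_right_mono norm_ge_zero norm_star)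
  finally have "norm (adj m x) * norm (adj m x) \<le> norm (adj m x) * (norm m * norm x)"
    by (simp add: power2_eq_square mult.commute mult.left_commute)
  then show ?thesis using False by simp
qed

instance
proof
  fix m n k :: "'a multiplier" and r s :: real
  note simps = multiplier_vector_simps app_simps
  show "dist m n = norm (m - n)" by (simp add: dist_multiplier_def)
  show "sgn m = scaleR (inverse (norm m)) m" by (simp add: sgn_multiplier_def)
  show "uniformity = (INF e\<in>{0<..}. principal {(m :: 'a multiplier, n). dist m n < e})"
    by (simp add: uniformity_multiplier_def)
  show "open U \<longleftrightarrow> (\<forall>x\<in>U. eventually (\<lambda>(x', y). x' = x \<longrightarrow> y \<in> U) uniformity)"
    for U :: "'a multiplier set" by (simp add: open_multiplier_def)
  show "m + n + k = m + (n + k)" "m + n = n + m" "0 + m = m" "- m + m = 0" "m - n = m + - n"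
    by (rule multiplier_eqI; simp add: simps algebra_simps)+
  show "r *\<^sub>R (m + n) = r *\<^sub>R m + r *\<^sub>R n" "(r + s) *\<^sub>R m = r *\<^sub>R m + s *\<^sub>R m"
    "r *\<^sub>R s *\<^sub>R m = (r * s) *\<^sub>R m" "1 *\<^sub>R m = m"
    by (rule multiplier_eqI; simp add: simps algebra_simps)+
  show "norm m = 0 \<longleftrightarrow> m = 0"
  proof
    assume "norm m = 0"
    then have "norm (app m x) \<le> 0" for x using norm_app_le[of m x] by simp
    then show "m = 0" by (intro multiplier_eqI) (simp add: simps)
  next
    assume "m = 0"
    then show "norm m = 0"
      using norm_multiplier_le[of 0 m] norm_multiplier_ge_zero[of m] by (simp add: simps)
  qed
  show "norm (m + n) \<le> norm m + norm n"
  proof (rule norm_multiplier_le)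
    show "norm (app (m + n) x) \<le> (norm m + norm n) * norm x" for x
      using norm_triangle_ineq[of "app m x" "app n x"] norm_app_le[of m x] norm_app_le[of n x]
      by (simp add: simps distrib_right)
  qed (simp add: norm_multiplier_ge_zero)
  have le: "norm (r *\<^sub>R m) \<le> \<bar>r\<bar> * norm m" for r and m :: "'a multiplier"
    by (rule norm_multiplier_le)
      (simp_all add: norm_multiplier_ge_zero simps mult.assoc mult_left_mono norm_app_le)
  show "norm (r *\<^sub>R m) = \<bar>r\<bar> * norm m"
  proof (cases "r = 0")
    case True
    then show ?thesis using le[of r m] norm_multiplier_ge_zero[of "r *\<^sub>R m"] by simp
  next
    case False
    have "inverse r *\<^sub>R r *\<^sub>R m = m" by (rule multiplier_eqI) (simp add: simps False)
    then have "norm m \<le> inverse \<bar>r\<bar> * norm (r *\<^sub>R m)"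
      using le[of "inverse r" "r *\<^sub>R m"] by simp
    then have "\<bar>r\<bar> * norm m \<le> norm (r *\<^sub>R m)" using False by (simp add: field_simps)
    then show ?thesis using le[of r m] by simp
  qed
qed

end

instance multiplier :: (cstar_algebra) banach
proof
  show "convergent X" if X: "Cauchy X" for X :: "nat \<Rightarrow> 'a multiplier"
  proof -
    have small: "\<exists>M. \<forall>i\<ge>M. \<forall>j\<ge>M. norm (X i - X j) < e" if "e > 0" for e
      using X that unfolding Cauchy_def dist_norm by blast
    have blin: "\<exists>F. bounded_linear F \<and> (\<forall>x. (\<lambda>i. f (X i) x) \<longlonglongrightarrow> F x)
        \<and> (\<forall>e>0. \<exists>M. \<forall>i\<ge>M. \<forall>x. norm (f (X i) x - F x) \<le> e * norm x)"
      if f: "\<And>m. bounded_linear (f m)" "\<And>m n x. f (m - n) x = f m x - f n x"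
        "\<And>m x. norm (f m x) \<le> norm m * norm x" for f :: "'a multiplier \<Rightarrow> 'a \<Rightarrow> 'a"
    proof -
      define G where "G i = Blinfun (f (X i))" for i
      have G: "blinfun_apply (G i) = f (X i)" for i
        by (simp add: G_def bounded_linear_Blinfun_apply f)
      have Gn: "norm (G i - G j) \<le> norm (X i - X j)" for i j
        using f(3)[of "X i - X j"] norm_multiplier_ge_zero
        by (intro norm_blinfun_bound) (simp_all add: blinfun.diff_left G f(2))
      have "Cauchy G"
        unfolding Cauchy_def dist_norm using small Gn by (meson le_less_trans)
      then obtain H where H: "G \<longlonglongrightarrow> H" using Cauchy_convergent convergent_def by blast
      show ?thesis
      proof (intro exI[of _ "blinfun_apply H"] conjI allI impI)
        show "bounded_linear (blinfun_apply H)" by (rule blinfun.bounded_linear_right)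
        show "(\<lambda>i. f (X i) x) \<longlonglongrightarrow> blinfun_apply H x" for x
          using blinfun.tendsto[OF H tendsto_const[of x]] by (simp add: G)
        fix e :: real assume "e > 0"
        then obtain M where M: "\<And>i. i \<ge> M \<Longrightarrow> norm (G i - H) < e"
          using H unfolding LIMSEQ_iff by blast
        have "norm (f (X i) x - blinfun_apply H x) \<le> e * norm x" if "i \<ge> M" for i x
        proof -
          have "norm (blinfun_apply (G i - H) x) \<le> norm (G i - H) * norm x" by (rule norm_blinfun)
          also have "\<dots> \<le> e * norm x" using M[OF that] by (intro mult_right_mono) auto
          finally show ?thesis by (simp add: blinfun.diff_left G)
        qed
        then show "\<exists>M. \<forall>i\<ge>M. \<forall>x. norm (f (X i) x - blinfun_apply H x) \<le> e * norm x" by blast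
      qed
    qed
    obtain F where F: "bounded_linear F" "\<And>x. (\<lambda>i. app (X i) x) \<longlonglongrightarrow> F x"
      "\<And>e. e > 0 \<Longrightarrow> \<exists>M. \<forall>i\<ge>M. \<forall>x. norm (app (X i) x - F x) \<le> e * norm x"
      using blin[of app, OF bounded_linear_app multiplier_vector_simps(3) norm_app_le] by metis
    obtain F' where F': "bounded_linear F'" "\<And>x. (\<lambda>i. adj (X i) x) \<longlonglongrightarrow> F' x"
      using blin[of adj, OF bounded_linear_adj multiplier_vector_simps(7) norm_adj_le] by metis
    have "star (F x) * y = star x * F' y" for x y
    proof (rule LIMSEQ_unique)
      show "(\<lambda>i. star (app (X i) x) * y) \<longlonglongrightarrow> star (F x) * y"
        by (intro tendsto_intros tendsto_star F)
      show "(\<lambda>i. star (app (X i) x) * y) \<longlonglongrightarrow> star x * F' y"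
        unfolding star_app_mult by (intro tendsto_intros F')
    qed
    then have L: "app (multiplier_of F F') = F" using F(1) F'(1) by (intro multiplier_of)
    have "X \<longlonglongrightarrow> multiplier_of F F'"
      unfolding lim_sequentially
    proof (intro allI impI)
      fix e :: real assume e: "e > 0"
      then obtain M where M: "\<And>i x. i \<ge> M \<Longrightarrow> norm (app (X i) x - F x) \<le> e / 2 * norm x"
        using F(3)[of "e / 2"] by auto
      have "norm (X i - multiplier_of F F') \<le> e / 2" if "i \<ge> M" for i
        using M[OF that] e by (intro norm_multiplier_le) (auto simp: multiplier_vector_simps L)
      then show "\<exists>M. \<forall>i\<ge>M. dist (X i) (multiplier_of F F') < e"
        using e unfolding dist_norm by (intro exI[of _ M]) fastforce
    qed
    then show ?thesis by (rule convergentI)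
  qed
qed

instantiation multiplier :: (cstar_algebra) cstar_algebra
begin

definition scaleC_multiplier :: "complex \<Rightarrow> 'a multiplier \<Rightarrow> 'a multiplier"
  where "c *\<^sub>C m = multiplier_of (\<lambda>x. c *\<^sub>C app m x) (\<lambda>x. cnj c *\<^sub>C adj m x)"
definition times_multiplier :: "'a multiplier \<Rightarrow> 'a multiplier \<Rightarrow> 'a multiplier"
  where "m * n = multiplier_of (\<lambda>x. app m (app n x)) (\<lambda>x. adj n (adj m x))"
definition star_multiplier :: "'a multiplier \<Rightarrow> 'a multiplier"
  where "star m = multiplier_of (adj m) (app m)"
lemma multiplier_algebra_simps:
  fixes m n :: "'a multiplier"
  shows "app (c *\<^sub>C m) x = c *\<^sub>C app m x"
    and "app (m * n) x = app m (app n x)"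
    and "app (star m) x = adj m x"
    and "adj (star m) x = app m x"
    and "adj (c *\<^sub>C m) x = cnj c *\<^sub>C adj m x"
    and "adj (m * n) x = adj n (adj m x)"
proof -
  note bl = bounded_linear_app bounded_linear_adj
    bounded_linear_compose[OF bounded_linear_scaleC bounded_linear_app]
    bounded_linear_compose[OF bounded_linear_scaleC bounded_linear_adj]
    bounded_linear_compose[OF bounded_linear_app bounded_linear_app]
    bounded_linear_compose[OF bounded_linear_adj bounded_linear_adj]
  note st = star_simps star_app_mult mult_star_adj mult_scaleC_left mult_scaleC_right
  show "app (c *\<^sub>C m) x = c *\<^sub>C app m x" "adj (c *\<^sub>C m) x = cnj c *\<^sub>C adj m x"
    by (simp_all add: scaleC_multiplier_def multiplier_of bl st)
  show "app (m * n) x = app m (app n x)" "adj (m * n) x = adj n (adj m x)"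
    by (simp_all add: times_multiplier_def multiplier_of bl st)
  show "app (star m) x = adj m x" "adj (star m) x = app m x"
    by (simp_all add: star_multiplier_def multiplier_of bl st)
qed

lemmas multiplier_simps = multiplier_vector_simps multiplier_algebra_simps

instance
proof
  fix m n k :: "'a multiplier" and r s :: real and c d :: complex
  note simps = multiplier_simps app_simps app_scaleC
  show "m * n * k = m * (n * k)" "(m + n) * k = m * k + n * k" "m * (n + k) = m * n + m * k"
    "r *\<^sub>R m * n = r *\<^sub>R (m * n)" "m * r *\<^sub>R n = r *\<^sub>R (m * n)"
    by (rule multiplier_eqI; simp add: simps algebra_simps)+
  show "c *\<^sub>C (m + n) = c *\<^sub>C m + c *\<^sub>C n" "(c + d) *\<^sub>C m = c *\<^sub>C m + d *\<^sub>C m"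
    "c *\<^sub>C d *\<^sub>C m = (c * d) *\<^sub>C m" "r *\<^sub>R m = complex_of_real r *\<^sub>C m"
    "c *\<^sub>C m * n = c *\<^sub>C (m * n)" "m * c *\<^sub>C n = c *\<^sub>C (m * n)"
    by (rule multiplier_eqI; simp add: simps scaleC_add_right scaleC_add_left scaleC_scaleC
        scaleR_eq_scaleC)+
  show "star (star m) = m" "star (m + n) = star m + star n" "star (c *\<^sub>C m) = cnj c *\<^sub>C star m"
    "star (m * n) = star n * star m"
    by (rule multiplier_eqI; simp add: simps)+
  have le: "norm (c *\<^sub>C m) \<le> cmod c * norm m" for c and m :: "'a multiplier"
    by (rule norm_multiplier_le)
      (simp_all add: simps norm_scaleC mult.assoc mult_left_mono norm_app_le)
  show "norm (c *\<^sub>C m) = cmod c * norm m"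
  proof (cases "c = 0")
    case True
    then show ?thesis using le[of c m] by simp
  next
    case False
    have "inverse c *\<^sub>C c *\<^sub>C m = m"
      by (rule multiplier_eqI) (simp add: simps scaleC_scaleC False)
    then have "norm m \<le> inverse (cmod c) * norm (c *\<^sub>C m)"
      using le[of "inverse c" "c *\<^sub>C m"] by (simp add: norm_inverse)
    then have "cmod c * norm m \<le> norm (c *\<^sub>C m)" using False by (simp add: field_simps)
    then show ?thesis using le[of c m] by simp
  qed
  show "norm (m * n) \<le> norm m * norm n"
  proof (rule norm_multiplier_le)
    show "norm (app (m * n) x) \<le> norm m * norm n * norm x" for x
      using norm_app_le[of m "app n x"] mult_left_mono[OF norm_app_le[of n x] norm_multiplier_ge_zero[of m]]
      by (simp add: simps)
  qed (simp add: norm_multiplier_ge_zero)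
  show "norm (star m * m) = (norm m)\<^sup>2"
  proof (rule antisym)
    show "norm (star m * m) \<le> (norm m)\<^sup>2"
    proof (rule norm_multiplier_le)
      show "norm (app (star m * m) x) \<le> (norm m)\<^sup>2 * norm x" for x
        using norm_adj_le[of m "app m x"] mult_left_mono[OF norm_app_le[of m x] norm_multiplier_ge_zero[of m]]
        by (simp add: simps power2_eq_square)
    qed simp
    let ?K = "norm (star m * m)"
    have K: "0 \<le> ?K" by (rule norm_multiplier_ge_zero)
    have "norm m \<le> sqrt ?K"
    proof (rule norm_multiplier_le)
      show "norm (app m x) \<le> sqrt ?K * norm x" for x
      proof -
        have "(norm (app m x))\<^sup>2 = norm (star x * app (star m * m) x)"
          by (simp add: cstar_identity[symmetric] star_app_mult simps)
        also have "\<dots> \<le> norm x * (?K * norm x)"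
          by (rule order_trans[OF norm_mult_ineq]) (simp add: mult_left_mono norm_app_le)
        also have "\<dots> = (sqrt ?K * norm x)\<^sup>2" using K by (simp add: power_mult_distrib power2_eq_square)
        finally show ?thesis by (rule power2_le_imp_le) (use K in simp)
      qed
    qed (use K in simp)
    then have "(norm m)\<^sup>2 \<le> (sqrt ?K)\<^sup>2" by (intro power_mono norm_multiplier_ge_zero)
    then show "(norm m)\<^sup>2 \<le> ?K" using K by simp
  qed
qed

end

instantiation multiplier :: (cstar_algebra) monoid_mult
begin

definition one_multiplier :: "'a multiplier"
  where "1 = multiplier_of (\<lambda>x. x) (\<lambda>x. x :: 'a)"

lemma app_one: "app (1 :: 'a multiplier) x = x"
  by (simp add: one_multiplier_def multiplier_of)

instance
  by standard (rule multiplier_eqI; simp add: multiplier_simps app_one)+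

end

definition left_mult :: "'a::cstar_algebra \<Rightarrow> 'a multiplier"
  where "left_mult a = multiplier_of (\<lambda>x. a * x) (\<lambda>x. star a * x)"

lemma app_left_mult: "app (left_mult a) x = a * x"
  and adj_left_mult: "adj (left_mult a) x = star a * x"
  unfolding left_mult_def
  by (subst multiplier_of; simp add: bounded_linear_mult_right star_mult star_star mult.assoc)+

lemmas left_mult_ops = app_left_mult adj_left_mult multiplier_simps

lemma left_mult_hom:
  "left_mult (a + b) = left_mult a + left_mult b"
  "left_mult (a - b) = left_mult a - left_mult b"
  "left_mult (r *\<^sub>R a) = r *\<^sub>R left_mult a"
  "left_mult (a * b) = left_mult a * left_mult b"
  "left_mult (star a) = star (left_mult a)"
  by (rule multiplier_eqI; simp add: left_mult_ops algebra_simps)+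

text \<open>
  The lower bound comes from evaluating the multiplier at \<open>a\<^sup>*\<close>.
\<close>

lemma norm_left_mult [simp]: "norm (left_mult a) = norm a"
proof (rule antisym)
  show "norm (left_mult a) \<le> norm a"
    by (rule norm_multiplier_le) (simp_all add: app_left_mult norm_mult_ineq)
  have "norm a * norm a \<le> norm (left_mult a) * norm a"
    using norm_app_le[of "left_mult a" "star a"]
    by (simp add: app_left_mult cstar_identity' power2_eq_square)
  then show "norm a \<le> norm (left_mult a)"
    by (cases "a = 0") auto
qed

section \<open>Transfer to algebras without unit\<close>

lemma cubic_norm_le:
  fixes v :: "'a::cstar_algebra"
  assumes "(norm v)\<^sup>2 \<le> 2"
  shows "norm (3 *\<^sub>R v - v * star v * v) \<le> 2"
proof -
  have "norm (3 *\<^sub>R left_mult v - left_mult v * star (left_mult v) * left_mult v) \<le> 2"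
    by (rule cubic_norm_le_unital) (simp add: assms)
  then show ?thesis by (simp flip: left_mult_hom)
qed

lemma tangent_norm_le:
  fixes z a :: "'a::cstar_algebra"
  assumes "norm z \<le> 1" "\<bar>t\<bar> * norm a \<le> 2 / 5"
  shows "norm (z + t *\<^sub>R (a - z * star a * z)) \<le> 1 + 3 * t\<^sup>2 * (norm a)\<^sup>2"
proof -
  let ?w = "z + t *\<^sub>R (a - z * star a * z)"
  have "(norm (left_mult z + t *\<^sub>R (left_mult a - left_mult z * star (left_mult a) * left_mult z)))\<^sup>2
      \<le> 1 + 5 * t\<^sup>2 * (norm (left_mult a))\<^sup>2"
    by (rule tangent_norm_le_unital) (use assms in simp_all)
  then have "(norm ?w)\<^sup>2 \<le> 1 + 5 * t\<^sup>2 * (norm a)\<^sup>2" by (simp flip: left_mult_hom)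
  also have "\<dots> \<le> (1 + 3 * t\<^sup>2 * (norm a)\<^sup>2)\<^sup>2"
  proof -
    have "1 + 5 * u \<le> (1 + 3 * u)\<^sup>2" if "u \<ge> 0" for u :: real
      using that by (simp add: power2_eq_square algebra_simps)
    from this[of "t\<^sup>2 * (norm a)\<^sup>2"] show ?thesis by (simp add: mult.assoc)
  qed
  finally show ?thesis by (rule power2_le_imp_le) simp
qed

section \<open>Local triple derivations are dissipative\<close>

lemma triple_derivation_cube:
  assumes "triple_derivation d"
  shows "d (y * star y * y) = d y * star y * y + y * star (d y) * y + y * star y * d y"
proof -
  have t: "triple_product a b a = a * star b * a" for a b :: 'a
    by (simp add: triple_product_def)
  have "d (triple_product y y y) =
      triple_product (d y) y y + triple_product y (d y) y + triple_product y y (d y)"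
    using assms unfolding triple_derivation_def by blast
  moreover have "triple_product (d y) y y + triple_product y y (d y) = d y * star y * y + y * star y * d y"
  proof -
    have "triple_product y y (d y) = triple_product (d y) y y"
      by (simp add: triple_product_def add.commute)
    moreover have "triple_product (d y) y y = (1 / 2) *\<^sub>R (d y * star y * y + y * star y * d y)"
      by (simp add: triple_product_def)
    ultimately show ?thesis by (metis scaleR_add_right scaleR_half_double)
  qed
  ultimately show ?thesis unfolding t by (simp add: algebra_simps)
qed

text \<open>
  Choose \<open>y\<close> in the unit ball with \<open>3 y - y y\<^sup>* y = 2 x\<close> and put \<open>c = \<delta> y\<close>. Then \<open>2 (x + t \<delta> x)\<close> agrees
  with \<open>3 v - v v\<^sup>* v\<close> at \<open>v = y + t c\<close> up to order \<open>t\<^sup>2\<close>, and the latter has norm at most \<open>2\<close> although \<open>v\<close>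
  may leave the unit ball to first order.
\<close>

lemma triple_derivation_tangent:
  fixes x :: "'a::cstar_algebra"
  assumes d: "triple_derivation d" and x: "norm x \<le> 1"
  obtains s0 C where "s0 > 0" "\<And>t. \<bar>t\<bar> \<le> s0 \<Longrightarrow> norm (x + t *\<^sub>R d x) \<le> 1 + C * t\<^sup>2"
proof -
  have lin: "clinear d" using d by (simp add: triple_derivation_def)
  obtain y where y: "norm y \<le> 1" "3 *\<^sub>R y - y * star y * y = 2 *\<^sub>R x"
    using cubic_preimage_exists[OF x] by blast
  define c where "c = d y"
  have dx: "2 *\<^sub>R d x = 3 *\<^sub>R c - (c * star y * y + y * star c * y + y * star y * c)"
    using arg_cong[OF y(2), of d] by (simp add: clinearD[OF lin] triple_derivation_cube[OF d] c_def)
  \<comment> \<open>For such times \<open>\<parallel>y + t c\<parallel> \<le> 4 / 3 < \<surd>2\<close>.\<close>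
  define s0 where "s0 = 1 / (3 * (norm c + 1))"
  have s0: "s0 > 0" "s0 \<le> 1" "s0 * norm c \<le> 1 / 3"
  proof -
    have pos: "0 < 3 * (norm c + 1)" by (intro mult_pos_pos add_nonneg_pos) auto
    show "s0 > 0" unfolding s0_def by (rule divide_pos_pos[OF zero_less_one pos])
    show "s0 \<le> 1" "s0 * norm c \<le> 1 / 3"
      unfolding s0_def times_divide_eq_left pos_divide_le_eq[OF pos] by simp_all
  qed
  define C where "C = (3 * (norm c)\<^sup>2 + (norm c)^3) / 2"
  have "norm (x + t *\<^sub>R d x) \<le> 1 + C * t\<^sup>2" if t: "\<bar>t\<bar> \<le> s0" for t
  proof -
    let ?v = "y + t *\<^sub>R c"
    define r where "r = y * star c * c + c * star y * c + c * star c * y + t *\<^sub>R (c * star c * c)"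
    have "norm (t *\<^sub>R c) \<le> 1 / 3"
      using mult_right_mono[OF t norm_ge_zero[of c]] s0 by simp
    then have "norm ?v \<le> 4 / 3" using y(1) norm_triangle_ineq[of y "t *\<^sub>R c"] by linarith
    then have "(norm ?v)\<^sup>2 \<le> (4 / 3)\<^sup>2" by (intro power_mono) auto
    then have "norm (3 *\<^sub>R ?v - ?v * star ?v * ?v) \<le> 2"
      by (intro cubic_norm_le) (simp add: power2_eq_square)
    moreover have eq: "2 *\<^sub>R (x + t *\<^sub>R d x) = (3 *\<^sub>R ?v - ?v * star ?v * ?v) + t\<^sup>2 *\<^sub>R r"
    proof -
      have "2 *\<^sub>R (x + t *\<^sub>R d x) = 2 *\<^sub>R x + t *\<^sub>R (2 *\<^sub>R d x)" by (simp add: scaleR_add_right)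
      also have "\<dots> = (3 *\<^sub>R y - y * star y * y) +
          t *\<^sub>R (3 *\<^sub>R c - (c * star y * y + y * star c * y + y * star y * c))"
        by (simp only: y(2) dx)
      also have "\<dots> = (3 *\<^sub>R ?v - ?v * star ?v * ?v) + t\<^sup>2 *\<^sub>R r"
        by (simp add: r_def star_simps algebra_simps power2_eq_square)
      finally show ?thesis .
    qed
    moreover have "norm r \<le> 3 * (norm c)\<^sup>2 + (norm c)^3"
    proof -
      have 1: "norm (y * star c * c) \<le> 1 * norm c * norm c"
        using y(1) by (intro order_trans[OF norm_mult3_le] mult_mono) auto
      have 2: "norm (c * star y * c) \<le> norm c * 1 * norm c"
        using y(1) by (intro order_trans[OF norm_mult3_le] mult_mono) auto
      have 3: "norm (c * star c * y) \<le> norm c * norm c * 1"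
        using y(1) by (intro order_trans[OF norm_mult3_le] mult_mono) auto
      have "norm (c * star c * c) \<le> norm c * norm c * norm c"
        using norm_mult3_le[of c "star c" c] by simp
      then have 4: "norm (t *\<^sub>R (c * star c * c)) \<le> 1 * (norm c * norm c * norm c)"
        unfolding norm_scaleR using t s0(2) by (intro mult_mono) auto
      have "norm r \<le> norm (y * star c * c) + norm (c * star y * c) + norm (c * star c * y)
          + norm (t *\<^sub>R (c * star c * c))"
        unfolding r_def by (meson norm_triangle_le add_mono order_refl)
      then show ?thesis using 1 2 3 4 by (simp add: power2_eq_square power3_eq_cube)
    qed
    then have "norm (t\<^sup>2 *\<^sub>R r) \<le> t\<^sup>2 * (3 * (norm c)\<^sup>2 + (norm c)^3)" by (simp add: mult_left_mono)
    ultimately have "norm (2 *\<^sub>R (x + t *\<^sub>R d x)) \<le> 2 + t\<^sup>2 * (3 * (norm c)\<^sup>2 + (norm c)^3)"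
      unfolding eq using norm_triangle_ineq[of "3 *\<^sub>R ?v - ?v * star ?v * ?v" "t\<^sup>2 *\<^sub>R r"] by linarith
    then have "2 * norm (x + t *\<^sub>R d x) \<le> 2 + t\<^sup>2 * (3 * (norm c)\<^sup>2 + (norm c)^3)"
      by (simp only: norm_scaleR)
    moreover have "2 * (1 + C * t\<^sup>2) = 2 + t\<^sup>2 * (3 * (norm c)\<^sup>2 + (norm c)^3)"
      by (simp add: C_def)
    ultimately have "2 * norm (x + t *\<^sub>R d x) \<le> 2 * (1 + C * t\<^sup>2)" by (simp only:)
    then show ?thesis by (rule mult_left_le_imp_le) simp
  qed
  with s0 show thesis using that by blast
qed

text \<open>
  The assumption for \<open>\<theta> t\<close> bounds \<open>\<parallel>x - \<theta> t u\<parallel>\<close> from below by \<open>1 - O(\<theta>\<^sup>2)\<close>, because \<open>x\<close> is the midpoint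
  of \<open>x \<plusminus> \<theta> t u\<close>. Convexity bounds it from above by \<open>1 - \<theta> (1 - \<parallel>x - t u\<parallel>)\<close>. Small \<open>\<theta>\<close> give the
  claim.
\<close>

lemma tangent_imp_dissipative:
  fixes x u :: "'a::real_normed_vector"
  assumes x: "norm x = 1" and s0: "s0 > 0"
    and tangent: "\<And>t. \<bar>t\<bar> \<le> s0 \<Longrightarrow> norm (x + t *\<^sub>R u) \<le> 1 + C * t\<^sup>2"
  shows "1 \<le> norm (x - t *\<^sub>R u)"
proof (rule ccontr)
  assume "\<not> 1 \<le> norm (x - t *\<^sub>R u)"
  then have gap: "1 - norm (x - t *\<^sub>R u) > 0" by simp
  have ev: "1 - norm (x - t *\<^sub>R u) \<le> C * \<theta> * t\<^sup>2" if \<theta>: "0 < \<theta>" "\<theta> \<le> 1" "\<theta> * \<bar>t\<bar> \<le> s0" for \<theta>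
  proof -
    have "x - (\<theta> * t) *\<^sub>R u = (1 - \<theta>) *\<^sub>R x + \<theta> *\<^sub>R (x - t *\<^sub>R u)" by (simp add: algebra_simps)
    then have "norm (x - (\<theta> * t) *\<^sub>R u) \<le> (1 - \<theta>) * 1 + \<theta> * norm (x - t *\<^sub>R u)"
      using norm_triangle_ineq[of "(1 - \<theta>) *\<^sub>R x" "\<theta> *\<^sub>R (x - t *\<^sub>R u)"] \<theta> x by simp
    moreover have "norm (x + (\<theta> * t) *\<^sub>R u) \<le> 1 + C * (\<theta> * t)\<^sup>2"
      by (rule tangent) (use \<theta> in \<open>simp add: abs_mult\<close>)
    moreover have "2 \<le> norm (x + (\<theta> * t) *\<^sub>R u) + norm (x - (\<theta> * t) *\<^sub>R u)"
      using norm_triangle_ineq[of "x + (\<theta> * t) *\<^sub>R u" "x - (\<theta> * t) *\<^sub>R u"] x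
      by (simp add: scaleR_2[symmetric])
    ultimately have "\<theta> * (1 - norm (x - t *\<^sub>R u)) \<le> \<theta> * (C * \<theta> * t\<^sup>2)"
      by (simp add: algebra_simps power2_eq_square)
    then show ?thesis using \<theta> by simp
  qed
  have "((\<lambda>\<theta>. C * \<theta> * t\<^sup>2) \<longlongrightarrow> C * 0 * t\<^sup>2) (at_right 0)" by (intro tendsto_intros)
  moreover have "\<forall>\<^sub>F \<theta> in at_right 0. 1 - norm (x - t *\<^sub>R u) \<le> C * \<theta> * t\<^sup>2"
    unfolding eventually_at_right_field
  proof (intro exI[of _ "min 1 (s0 / (\<bar>t\<bar> + 1))"] conjI allI impI)
    show "0 < min 1 (s0 / (\<bar>t\<bar> + 1))" using s0 by (simp add: add_nonneg_pos)
    fix \<theta> :: real assume \<theta>: "0 < \<theta>" "\<theta> < min 1 (s0 / (\<bar>t\<bar> + 1))"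
    then have "\<theta> * (\<bar>t\<bar> + 1) \<le> s0" by (simp add: field_simps add_nonneg_pos)
    then have "\<theta> * \<bar>t\<bar> \<le> s0" using \<theta> by (simp add: algebra_simps)
    with \<theta> show "1 - norm (x - t *\<^sub>R u) \<le> C * \<theta> * t\<^sup>2" by (intro ev) auto
  qed
  ultimately have "1 - norm (x - t *\<^sub>R u) \<le> C * 0 * t\<^sup>2"
    by (intro tendsto_lowerbound) auto
  with gap show False by simp
qed

lemma local_triple_derivation_dissipative:
  assumes "local_triple_derivation T"
  shows "norm x \<le> norm (x - t *\<^sub>R T x)"
proof (cases "x = 0")
  case False
  have lin: "clinear T" using assms by (simp add: local_triple_derivation_def)
  define u where "u = (1 / norm x) *\<^sub>R x"
  have u: "norm u = 1" using False by (simp add: u_def)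
  obtain d where d: "triple_derivation d" "T u = d u"
    using assms by (auto simp: local_triple_derivation_def)
  obtain s0 C where "s0 > 0" "\<And>t. \<bar>t\<bar> \<le> s0 \<Longrightarrow> norm (u + t *\<^sub>R d u) \<le> 1 + C * t\<^sup>2"
    using triple_derivation_tangent[OF d(1), of u] u by auto
  then have "1 \<le> norm (u - t *\<^sub>R T u)" using tangent_imp_dissipative[OF u] d(2) by metis
  also have "u - t *\<^sub>R T u = (1 / norm x) *\<^sub>R (x - t *\<^sub>R T x)"
    by (simp add: u_def clinearD[OF lin] scaleR_diff_right)
  finally have "1 \<le> norm (x - t *\<^sub>R T x) / norm x" by (simp only: norm_scaleR) simp
  then show ?thesis using False by (simp add: field_simps)
qed simp

section \<open>Dissipative operators\<close>

text \<open>
  Apply the dissipativity estimate to \<open>X n + t y\<close>, let \<open>n\<close> tend to infinity, divide by \<open>t\<close> and let \<open>t\<close>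
  tend to \<open>0\<close>.
\<close>

lemma dissipative_closed:
  fixes T :: "'a::real_normed_vector \<Rightarrow> 'a"
  assumes lin: "linear T" and diss: "\<And>x t. norm x \<le> norm (x - t *\<^sub>R T x)"
    and x: "X \<longlonglongrightarrow> 0" and y: "(\<lambda>n. T (X n)) \<longlonglongrightarrow> y"
  shows "y = 0"
proof -
  have le: "norm y \<le> t * norm (T y)" if t: "t > 0" for t
  proof -
    let ?z = "\<lambda>n. X n + t *\<^sub>R y"
    have "norm (?z n) \<le> norm (?z n - t *\<^sub>R (T (X n) + t *\<^sub>R T y))" for n
      using diss[of "?z n" t] by (simp add: linear_add[OF lin] linear_scale[OF lin])
    moreover have "(\<lambda>n. norm (?z n)) \<longlonglongrightarrow> norm (0 + t *\<^sub>R y)"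
      by (intro tendsto_intros x)
    moreover have "(\<lambda>n. norm (?z n - t *\<^sub>R (T (X n) + t *\<^sub>R T y)))
        \<longlonglongrightarrow> norm (0 + t *\<^sub>R y - t *\<^sub>R (y + t *\<^sub>R T y))"
      by (intro tendsto_intros x y)
    ultimately have "norm (0 + t *\<^sub>R y) \<le> norm (0 + t *\<^sub>R y - t *\<^sub>R (y + t *\<^sub>R T y))"
      by (intro LIMSEQ_le) auto
    then have "t * norm y \<le> t * (t * norm (T y))" using t by (simp add: scaleR_add_right)
    then show ?thesis using t by simp
  qed
  have "((\<lambda>t. t * norm (T y)) \<longlongrightarrow> 0 * norm (T y)) (at_right 0)" by (intro tendsto_intros)
  then have "norm y \<le> 0 * norm (T y)"
    using le by (intro tendsto_lowerbound[where F="at_right 0"])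
      (auto simp: eventually_at_right_field intro!: exI[of _ 1])
  then show ?thesis by simp
qed

text \<open>
  This is the closed graph theorem for \<open>T\<close>. By Baire's theorem some set \<open>{x. \<parallel>T x\<parallel> \<le> n}\<close> is dense in a
  ball, so that every \<open>u\<close> is approximated up to \<open>\<parallel>u\<parallel> / 2\<close> by some \<open>v\<close> with \<open>\<parallel>T v\<parallel> \<le> K \<parallel>u\<parallel>\<close>. Iterating on the
  remainders and using that \<open>T\<close> is closed, \<open>T u\<close> is a series of norm at most \<open>2 K \<parallel>u\<parallel>\<close>.
\<close>

lemma dissipative_bounded:
  fixes T :: "'a::banach \<Rightarrow> 'a"
  assumes lin: "linear T" and diss: "\<And>x t. norm x \<le> norm (x - t *\<^sub>R T x)"
  shows "bounded_linear T"
proof -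
  define S where "S n = closure {x. norm (T x) \<le> real n}" for n
  have "\<exists>n. interior (S n) \<noteq> {}"
  proof (rule ccontr)
    assume "\<not> ?thesis"
    then have S: "interior (S n) = {}" "closed (S n)" for n by (auto simp: S_def)
    have "euclidean interior_of \<Union> (range S) = {}"
    proof (rule Baire_category_alt)
      show "completely_metrizable_space (euclidean :: 'a topology)
          \<or> locally_compact_space (euclidean :: 'a topology) \<and> regular_space (euclidean :: 'a topology)"
        using completely_metrizable_space_euclidean by blast
      show "countable (range S)" by (rule countable_image) simp
      fix U assume "U \<in> range S"
      then show "closedin euclidean U \<and> euclidean interior_of U = {}"
        using S by auto
    qed
    moreover have "\<Union> (range S) = UNIV"
    proof -
      have "x \<in> \<Union> (range S)" for x
      proof -
        obtain n where "norm (T x) \<le> real n" using real_arch_simple by blast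
        then have "x \<in> S n" unfolding S_def by (intro subsetD[OF closure_subset]) simp
        then show ?thesis by blast
      qed
      then show ?thesis by blast
    qed
    ultimately show False by simp
  qed
  then obtain n x0 where "x0 \<in> interior (S n)" by blast
  then obtain r where r: "r > 0" "ball x0 r \<subseteq> S n" by (auto simp: mem_interior)
  define K where "K = 4 * real n / r"
  have K: "K \<ge> 0" using r by (simp add: K_def)
  have approx: "\<exists>v. norm (u - v) \<le> norm u / 2 \<and> norm (T v) \<le> K * norm u" for u
  proof (cases "u = 0")
    case True
    then show ?thesis by (intro exI[of _ 0]) (simp add: linear_0[OF lin])
  next
    case False
    \<comment> \<open>Scaling \<open>u\<close> by \<open>c\<close> moves \<open>x0 + c u\<close> half a radius away from the centre of the ball.\<close>
    define c where "c = r / (2 * norm u)"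
    have c: "c > 0" using r False by (simp add: c_def)
    have "x0 + c *\<^sub>R u \<in> S n" "x0 \<in> S n"
      using r c False by (auto intro!: subsetD[OF r(2)] simp: dist_norm c_def)
    then obtain a b where ab: "norm (T a) \<le> n" "norm (T b) \<le> n"
      "dist a (x0 + c *\<^sub>R u) < r / 8" "dist b x0 < r / 8"
      using r(1) unfolding S_def closure_approachable
      by (metis (mono_tags, lifting) mem_Collect_eq zero_less_divide_iff zero_less_numeral)
    define v where "v = (1 / c) *\<^sub>R (a - b)"
    have "c *\<^sub>R (u - v) = (b - x0) - (a - (x0 + c *\<^sub>R u))" using c by (simp add: v_def algebra_simps)
    then have "norm (c *\<^sub>R (u - v)) \<le> r / 8 + r / 8"
      using ab(3,4) norm_triangle_ineq4[of "b - x0" "a - (x0 + c *\<^sub>R u)"] by (simp add: dist_norm)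
    then have "norm (u - v) \<le> r / 4 / c"
      using c unfolding norm_scaleR by (simp add: field_simps)
    then have 1: "norm (u - v) \<le> norm u / 2" using r False by (simp add: c_def field_simps)
    have "norm (T a - T b) \<le> 2 * n" using ab norm_triangle_ineq4[of "T a" "T b"] by simp
    then have "norm (T v) \<le> 2 * n / c"
      using c by (simp add: v_def linear_diff[OF lin] linear_scale[OF lin] divide_right_mono)
    also have "\<dots> = K * norm u" using r False by (simp add: K_def c_def field_simps)
    finally show ?thesis using 1 by blast
  qed
  then obtain f where f: "\<And>u. norm (u - f u) \<le> norm u / 2" "\<And>u. norm (T (f u)) \<le> K * norm u"
    by metis
  have bound: "norm (T u) \<le> norm u * (K * 2)" for u
  proof -
    define R where "R k = ((\<lambda>v. v - f v) ^^ k) u" for k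
    have RS: "R 0 = u" "R (Suc k) = R k - f (R k)" for k by (simp_all add: R_def)
    have Rn: "norm (R k) \<le> norm u * (1 / 2) ^ k" for k
    proof (induction k)
      case (Suc k)
      have "norm (R (Suc k)) \<le> norm (R k) / 2" using f(1)[of "R k"] by (simp add: RS)
      also have "\<dots> \<le> norm u * (1 / 2) ^ k / 2" using Suc by (rule divide_right_mono) simp
      finally show ?case by simp
    qed (simp add: RS)
    have Tn: "norm (T (f (R k))) \<le> K * norm u * (1 / 2) ^ k" for k
      using f(2)[of "R k"] mult_left_mono[OF Rn[of k] K] by simp
    have geo: "(\<lambda>k. K * norm u * (1 / 2) ^ k) sums (K * norm u * 2)"
      using sums_mult[OF geometric_sums[of "1 / 2 :: real"], of "K * norm u"] by simp
    have sm: "summable (\<lambda>k. norm (T (f (R k))))"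
      by (rule summable_comparison_test'[OF sums_summable[OF geo], of 0]) (use Tn in simp)
    then have sums: "(\<lambda>k. T (f (R k))) sums (\<Sum>k. T (f (R k)))"
      by (rule summable_sums[OF summable_norm_cancel])
    have eq: "u - R N = (\<Sum>k<N. f (R k))" for N
      by (induction N) (simp_all add: RS algebra_simps)
    have "T (- R N) = (\<Sum>k<N. T (f (R k))) - T u" for N
    proof -
      have "- R N = (\<Sum>k<N. f (R k)) - u" by (simp flip: eq)
      then show ?thesis by (simp only: linear_diff[OF lin] linear_sum[OF lin])
    qed
    moreover have "(\<lambda>N. (\<Sum>k<N. T (f (R k))) - T u) \<longlonglongrightarrow> (\<Sum>k. T (f (R k))) - T u"
      using sums unfolding sums_def by (intro tendsto_intros)
    ultimately have T: "(\<lambda>N. T (- R N)) \<longlonglongrightarrow> (\<Sum>k. T (f (R k))) - T u" by simp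
    have "(\<lambda>N. norm u * (1 / 2) ^ N) \<longlonglongrightarrow> norm u * 0"
      by (intro tendsto_intros LIMSEQ_power_zero) auto
    then have "R \<longlonglongrightarrow> 0"
      by (intro Lim_null_comparison[of R]) (use Rn in auto)
    then have "(\<lambda>N. - R N) \<longlonglongrightarrow> 0" using tendsto_minus[of R 0] by simp
    from dissipative_closed[OF lin diss this T] have "T u = (\<Sum>k. T (f (R k)))" by simp
    also have "norm \<dots> \<le> (\<Sum>k. norm (T (f (R k))))" by (rule summable_norm[OF sm])
    also have "\<dots> \<le> (\<Sum>k. K * norm u * (1 / 2) ^ k)"
      by (rule suminf_le[OF Tn sm sums_summable[OF geo]])
    also have "\<dots> = K * norm u * 2" by (rule sums_unique[OF geo, symmetric])
    finally show ?thesis by (simp only: mult_ac)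
  qed
  show ?thesis
    using linear_add[OF lin] linear_scale[OF lin] bound by (intro bounded_linear_intro) 
qed

section \<open>The flow of a dissipative operator\<close>

text \<open>
  Dissipativity at \<open>x + h T x\<close> also yields the upper bound \<open>\<parallel>x + h T x\<parallel> \<le> \<parallel>x\<parallel> + O(h\<^sup>2)\<close>, since
  \<open>(1 - h T) (1 + h T) = 1 - h\<^sup>2 T\<^sup>2\<close>. Together with the lower bound it shows that the norm along a
  solution has derivative \<open>0\<close>.
\<close>

lemma dissipative_solution_norm_const:
  fixes T :: "'a::real_normed_vector \<Rightarrow> 'a"
  assumes T: "bounded_linear T" and diss: "\<And>x t. norm x \<le> norm (x - t *\<^sub>R T x)"
    and w: "\<And>s. (w has_vector_derivative T (w s)) (at s)"
  shows "norm (w s) = norm (w 0)"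
proof -
  have lin: "linear T" using T by (rule bounded_linear.linear)
  obtain K where K: "\<And>x. norm (T x) \<le> norm x * K" "K \<ge> 0"
    using bounded_linear.nonneg_bounded[OF T] by blast
  have up: "norm (x + h *\<^sub>R T x) \<le> norm x + h\<^sup>2 * (norm x * K * K)" for x h
  proof -
    let ?y = "x + h *\<^sub>R T x"
    have "norm ?y \<le> norm (?y - h *\<^sub>R T ?y)" by (rule diss)
    also have "?y - h *\<^sub>R T ?y = x - h\<^sup>2 *\<^sub>R T (T x)"
      by (simp add: linear_add[OF lin] linear_scale[OF lin] scaleR_add_right power2_eq_square)
    also have "norm \<dots> \<le> norm x + norm (h\<^sup>2 *\<^sub>R T (T x))" by (rule norm_triangle_ineq4)
    also have "norm (h\<^sup>2 *\<^sub>R T (T x)) \<le> h\<^sup>2 * (norm x * K * K)"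
      using K(1)[of "T x"] mult_right_mono[OF K(1)[of x] K(2)] by (simp add: mult_left_mono)
    finally show ?thesis by simp
  qed
  have lo: "norm x \<le> norm (x + h *\<^sub>R T x)" for x h using diss[of x "-h"] by simp
  have "((\<lambda>s. norm (w s)) has_real_derivative 0) (at s)" for s
    unfolding DERIV_def
  proof (rule Lim_null_comparison)
    let ?rem = "\<lambda>h. norm (w (s + h) - w s - h *\<^sub>R T (w s)) / norm h"
    show "\<forall>\<^sub>F h in at 0. norm ((norm (w (s + h)) - norm (w s)) / h)
        \<le> ?rem h + \<bar>h\<bar> * (norm (w s) * K * K)"
      unfolding eventually_at_filter
    proof (intro always_eventually allI impI)
      fix h :: real assume h: "h \<noteq> 0"
      have "\<bar>norm (w (s + h)) - norm (w s + h *\<^sub>R T (w s))\<bar> \<le> norm (w (s + h) - w s - h *\<^sub>R T (w s))"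
        using norm_triangle_ineq3[of "w (s + h)" "w s + h *\<^sub>R T (w s)"] by (simp add: algebra_simps)
      then have "\<bar>norm (w (s + h)) - norm (w s)\<bar>
          \<le> norm (w (s + h) - w s - h *\<^sub>R T (w s)) + h\<^sup>2 * (norm (w s) * K * K)"
        using up[of "w s" h] lo[of "w s" h] by linarith
      then have "\<bar>norm (w (s + h)) - norm (w s)\<bar> / \<bar>h\<bar>
          \<le> (norm (w (s + h) - w s - h *\<^sub>R T (w s)) + h\<^sup>2 * (norm (w s) * K * K)) / \<bar>h\<bar>"
        by (rule divide_right_mono) simp
      also have "\<dots> = ?rem h + \<bar>h\<bar> * (norm (w s) * K * K)"
      proof -
        have "h\<^sup>2 / \<bar>h\<bar> = \<bar>h\<bar>"
          using h by (cases "h > 0") (auto simp: power2_eq_square)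
        then show ?thesis by (metis add_divide_distrib real_norm_def times_divide_eq_left)
      qed
      finally show "norm ((norm (w (s + h)) - norm (w s)) / h)
          \<le> ?rem h + \<bar>h\<bar> * (norm (w s) * K * K)" by simp
    qed
    have "(?rem \<longlongrightarrow> 0) (at 0)"
      using w[of s] unfolding has_vector_derivative_def has_derivative_at by blast
    then have "((\<lambda>h. ?rem h + \<bar>h\<bar> * (norm (w s) * K * K)) \<longlongrightarrow> 0 + \<bar>0\<bar> * (norm (w s) * K * K)) (at 0)"
      by (intro tendsto_intros)
    then show "((\<lambda>h. ?rem h + \<bar>h\<bar> * (norm (w s) * K * K)) \<longlongrightarrow> 0) (at 0)" by simp
  qed
  then show ?thesis by (rule DERIV_isconst_all[rule_format])
qed

text \<open>
  The solution is the exponential series \<open>w s = (\<Sum>n. s\<^sup>n T\<^sup>n x / n!)\<close>, differentiated term by term.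
\<close>

lemma bounded_linear_flow_exists:
  fixes T :: "'a::banach \<Rightarrow> 'a"
  assumes T: "bounded_linear T"
  obtains w where "w 0 = x" "\<And>s. (w has_vector_derivative T (w s)) (at s)"
proof -
  have lin: "linear T" using T by (rule bounded_linear.linear)
  obtain K where K: "\<And>x. norm (T x) \<le> norm x * K" "K \<ge> 0"
    using bounded_linear.nonneg_bounded[OF T] by blast
  define a where "a n = (T ^^ n) x /\<^sub>R fact n" for n
  have Ta: "T (a n) = real (Suc n) *\<^sub>R a (Suc n)" for n
    by (simp add: a_def linear_scale[OF lin])
  have pow: "norm ((T ^^ n) x) \<le> K ^ n * norm x" for n
  proof (induction n)
    case (Suc n)
    have "norm ((T ^^ Suc n) x) \<le> norm ((T ^^ n) x) * K" using K(1) by simp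
    also have "\<dots> \<le> K ^ n * norm x * K" using Suc K(2) by (intro mult_right_mono)
    finally show ?case by (simp add: mult_ac)
  qed simp
  have na: "norm (a n) \<le> inverse (fact n) * K ^ n * norm x" for n
    using pow[of n] by (simp add: a_def mult_left_mono mult.assoc)
  define w where "w s = (\<Sum>n. s ^ n *\<^sub>R a n)" for s
  have sm: "summable (\<lambda>n. s ^ n *\<^sub>R a n)" for s
  proof (rule summable_comparison_test')
    show "summable (\<lambda>n. (inverse (fact n) * (\<bar>s\<bar> * K) ^ n) * norm x)"
      using summable_exp[of "\<bar>s\<bar> * K"] by (intro summable_mult2)
    show "norm (s ^ n *\<^sub>R a n) \<le> (inverse (fact n) * (\<bar>s\<bar> * K) ^ n) * norm x" if "n \<ge> 0" for n
      using mult_left_mono[OF na[of n], of "\<bar>s\<bar> ^ n"] by (simp add: power_abs power_mult_distrib mult_ac)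
  qed
  have "w 0 = (\<Sum>n\<in>{0}. 0 ^ n *\<^sub>R a n)"
    unfolding w_def by (rule suminf_finite) auto
  then have w0: "w 0 = x" by (simp add: a_def)
  have "(w has_vector_derivative T (w s)) (at s)" for s
  proof -
    define r where "r = \<bar>s\<bar> + 1"
    define S where "S = ball (0::real) r"
    have sS: "s \<in> S" by (simp add: S_def r_def)
    define M where "M n = (inverse (fact n) * (r * K) ^ n) * (norm x * K)" for n
    have sumM: "summable M" unfolding M_def
      using summable_exp[of "r * K"] by (intro summable_mult2)
    have Mb: "norm (T (t ^ n *\<^sub>R a n)) \<le> M n" if "t \<in> S" for t n
    proof -
      have "norm (T (t ^ n *\<^sub>R a n)) \<le> norm (t ^ n *\<^sub>R a n) * K" by (rule K)
      also have "\<dots> \<le> (r ^ n * (inverse (fact n) * K ^ n * norm x)) * K"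
        unfolding norm_scaleR using that na[of n] K(2)
        by (intro mult_right_mono mult_mono) (auto simp: power_abs S_def intro!: power_mono)
      finally show ?thesis by (simp add: M_def power_mult_distrib mult_ac)
    qed
    have unif: "uniform_limit S (\<lambda>n t. \<Sum>i<n. T (t ^ i *\<^sub>R a i)) (\<lambda>t. \<Sum>i. T (t ^ i *\<^sub>R a i)) sequentially"
      by (rule Weierstrass_m_test[OF Mb sumM])
    have Tw: "(\<Sum>i. T (t ^ i *\<^sub>R a i)) = T (w t)" for t
      unfolding w_def using bounded_linear.suminf[OF T sm] by simp
    define f' where "f' n t h = h *\<^sub>R ((real n * t ^ (n - 1)) *\<^sub>R a n)" for n and t h :: real
    have f'S: "(\<Sum>i<Suc n. f' i t h) = h *\<^sub>R (\<Sum>i<n. T (t ^ i *\<^sub>R a i))" for n t h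
    proof -
      have "(\<Sum>i<Suc n. f' i t h) = f' 0 t h + (\<Sum>i<n. f' (Suc i) t h)"
        by (rule sum.lessThan_Suc_shift)
      also have "\<dots> = h *\<^sub>R (\<Sum>i<n. T (t ^ i *\<^sub>R a i))"
        by (simp add: f'_def linear_scale[OF lin] Ta scaleR_sum_right mult_ac)
      finally show ?thesis .
    qed
    have "\<exists>g. \<forall>t\<in>S. (\<lambda>n. t ^ n *\<^sub>R a n) sums (g t) \<and>
        (g has_derivative (\<lambda>h. h *\<^sub>R T (w t))) (at t within S)"
    proof (rule has_derivative_series[where f' = f'])
      show "convex S" by (simp add: S_def)
      show "s \<in> S" by (rule sS)
      show "(\<lambda>n. s ^ n *\<^sub>R a n) sums w s" unfolding w_def using sm by (rule summable_sums)
      show "((\<lambda>t. t ^ n *\<^sub>R a n) has_derivative f' n t) (at t within S)" for n t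
        unfolding f'_def by (auto intro!: derivative_eq_intros simp: mult_ac)
      fix e :: real assume e: "e > 0"
      then have "\<forall>\<^sub>F n in sequentially. \<forall>t\<in>S. dist (\<Sum>i<n. T (t ^ i *\<^sub>R a i)) (T (w t)) < e"
        using unif unfolding Tw uniform_limit_iff by blast
      then have "\<forall>\<^sub>F n in sequentially. \<forall>t\<in>S. \<forall>h. norm (sum (\<lambda>i. f' i t h) {..<Suc n} - h *\<^sub>R T (w t)) \<le> e * norm h"
      proof (rule eventually_mono)
        fix n assume n: "\<forall>t\<in>S. dist (\<Sum>i<n. T (t ^ i *\<^sub>R a i)) (T (w t)) < e"
        show "\<forall>t\<in>S. \<forall>h. norm (sum (\<lambda>i. f' i t h) {..<Suc n} - h *\<^sub>R T (w t)) \<le> e * norm h"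
        proof (intro ballI allI)
          fix t h assume "t \<in> S"
          then have le: "norm ((\<Sum>i<n. T (t ^ i *\<^sub>R a i)) - T (w t)) \<le> e"
            using n by (auto simp: dist_norm less_imp_le)
          then show "norm (sum (\<lambda>i. f' i t h) {..<Suc n} - h *\<^sub>R T (w t)) \<le> e * norm h"
            unfolding f'S scaleR_diff_right[symmetric] norm_scaleR
            using mult_right_mono[OF le, of "\<bar>h\<bar>"] by (simp add: mult.commute)
        qed
      qed
      then show "\<forall>\<^sub>F n in sequentially. \<forall>t\<in>S. \<forall>h. norm (sum (\<lambda>i. f' i t h) {..<n} - h *\<^sub>R T (w t)) \<le> e * norm h"
        by (subst eventually_sequentially_Suc[symmetric])
    qed
    then obtain g where g: "\<And>t. t \<in> S \<Longrightarrow> (\<lambda>n. t ^ n *\<^sub>R a n) sums g t"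
      "\<And>t. t \<in> S \<Longrightarrow> (g has_derivative (\<lambda>h. h *\<^sub>R T (w t))) (at t within S)" by blast
    have op: "open S" by (simp add: S_def)
    have "(g has_derivative (\<lambda>h. h *\<^sub>R T (w s))) (at s)"
      using g(2)[OF sS] at_within_open[OF sS op] by simp
    then have "(w has_derivative (\<lambda>h. h *\<^sub>R T (w s))) (at s)"
      by (rule has_derivative_transform_within_open[OF _ op sS]) (use g(1) in \<open>simp add: w_def sums_iff\<close>)
    then show ?thesis by (simp add: has_vector_derivative_def)
  qed
  with w0 show thesis using that by blast
qed

section \<open>Vector-valued polynomials in a complex variable\<close>

text \<open>
  Polynomials \<open>\<Sum>j. \<epsilon>\<^sup>j c\<^sub>j\<close> with coefficients in the algebra, generated by the Horner scheme. In this form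
  closure under bilinear maps is a simple induction.
\<close>

inductive vpoly :: "(complex \<Rightarrow> 'a::cstar_algebra) \<Rightarrow> bool" where
  const: "vpoly (\<lambda>_. c)"
| step: "vpoly p \<Longrightarrow> vpoly (\<lambda>\<epsilon>. c + \<epsilon> *\<^sub>C p \<epsilon>)"

lemma vpoly_add: "vpoly p \<Longrightarrow> vpoly q \<Longrightarrow> vpoly (\<lambda>\<epsilon>. p \<epsilon> + q \<epsilon>)"
proof (induction p arbitrary: q rule: vpoly.induct)
  case (const c)
  from const show ?case
  proof cases
    case (const d)
    then show ?thesis by (simp add: vpoly.const)
  next
    case (step r d)
    then show ?thesis using vpoly.step[of r "c + d"] by (simp add: add.assoc)
  qed
next
  case (step p c)
  from step.prems show ?case
  proof cases
    case (const d)
    then show ?thesis using vpoly.step[OF step.hyps, of "c + d"] by (simp add: ac_simps)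
  next
    case (step r d)
    have "vpoly (\<lambda>\<epsilon>. (c + d) + \<epsilon> *\<^sub>C (p \<epsilon> + r \<epsilon>))"
      by (intro vpoly.step) (use step \<open>\<And>q. vpoly q \<Longrightarrow> vpoly (\<lambda>\<epsilon>. p \<epsilon> + q \<epsilon>)\<close> in blast)
    then show ?thesis using step by (simp add: scaleC_add_right ac_simps)
  qed
qed

lemma vpoly_shift: "vpoly p \<Longrightarrow> vpoly (\<lambda>\<epsilon>. \<epsilon> *\<^sub>C p \<epsilon>)"
  using vpoly.step[of p 0] by simp

lemma vpoly_bilinear:
  fixes B :: "'a::cstar_algebra \<Rightarrow> 'a \<Rightarrow> 'a"
  assumes B: "\<And>u v w. B (u + v) w = B u w + B v w" "\<And>u v w. B u (v + w) = B u v + B u w"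
    "\<And>c u v. B (c *\<^sub>C u) v = c *\<^sub>C B u v" "\<And>c u v. B u (c *\<^sub>C v) = c *\<^sub>C B u v"
  shows "vpoly p \<Longrightarrow> vpoly q \<Longrightarrow> vpoly (\<lambda>\<epsilon>. B (p \<epsilon>) (q \<epsilon>))"
proof (induction p arbitrary: q rule: vpoly.induct)
  case (const c)
  then show ?case
  proof (induction q rule: vpoly.induct)
    case (const d)
    then show ?case by (rule vpoly.const)
  next
    case (step q d)
    then show ?case using vpoly.step[of "\<lambda>\<epsilon>. B c (q \<epsilon>)" "B c d"] by (simp add: B)
  qed
next
  case (step p c)
  have "vpoly (\<lambda>\<epsilon>. B c (q \<epsilon>))"
    using step.prems
  proof (induction q rule: vpoly.induct)
    case (const d)
    then show ?case by (rule vpoly.const)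
  next
    case (step q d)
    then show ?case using vpoly.step[of "\<lambda>\<epsilon>. B c (q \<epsilon>)" "B c d"] by (simp add: B)
  qed
  from vpoly_add[OF this vpoly_shift[OF step.IH[OF step.prems]]] show ?case by (simp add: B)
qed

lemma vpoly_coefficients:
  assumes "vpoly p"
  obtains d c where "\<And>\<epsilon>. p \<epsilon> = (\<Sum>j\<le>d. (\<epsilon> ^ j) *\<^sub>C c j)"
proof -
  have "\<exists>d c. \<forall>\<epsilon>. p \<epsilon> = (\<Sum>j\<le>d. (\<epsilon> ^ j) *\<^sub>C c j)"
    using assms
  proof (induction p rule: vpoly.induct)
    case (const c)
    then show ?case by (intro exI[of _ 0] exI[of _ "\<lambda>_. c"]) simp
  next
    case (step p c0)
    then obtain d c where dc: "\<And>\<epsilon>. p \<epsilon> = (\<Sum>j\<le>d. (\<epsilon> ^ j) *\<^sub>C c j)" by blast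
    have "c0 + \<epsilon> *\<^sub>C p \<epsilon> = (\<Sum>j\<le>Suc d. (\<epsilon> ^ j) *\<^sub>C (case j of 0 \<Rightarrow> c0 | Suc i \<Rightarrow> c i))" for \<epsilon>
    proof -
      have "\<epsilon> *\<^sub>C sum f A = (\<Sum>j\<in>A. \<epsilon> *\<^sub>C f j)" for f :: "nat \<Rightarrow> 'a" and A
        by (induction A rule: infinite_finite_induct) (simp_all add: scaleC_add_right)
      then show ?thesis
        unfolding sum.atMost_Suc_shift dc by (simp add: scaleC_scaleC)
    qed
    then show ?case by blast
  qed
  then show thesis using that by blast
qed

text \<open>
  The value at the centre is the mean over the points \<open>r \<omega>\<^sup>m\<close> for a root of unity \<open>\<omega>\<close> whose order \<open>n\<close> exceeds
  the degree.
\<close>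

lemma vpoly_norm_center_le:
  fixes p :: "complex \<Rightarrow> 'a::cstar_algebra"
  assumes p: "vpoly p" and bound: "\<And>\<epsilon>. cmod \<epsilon> = r \<Longrightarrow> norm (p \<epsilon>) \<le> M" and r: "r \<ge> 0"
  shows "norm (p 0) \<le> M"
proof -
  obtain d c where dc: "\<And>\<epsilon>. p \<epsilon> = (\<Sum>j\<le>d. (\<epsilon> ^ j) *\<^sub>C c j)"
    using vpoly_coefficients[OF p] by blast
  define n where "n = Suc d"
  define \<omega> where "\<omega> = exp (2 * of_real pi * \<i> * of_nat 1 / of_nat n)"
  have \<omega>n: "\<omega> ^ n = 1" unfolding \<omega>_def by (rule complex_root_unity) (simp add: n_def)
  have \<omega>1: "cmod \<omega> = 1" by (simp add: \<omega>_def)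
  have root_sum: "(\<Sum>m<n. (complex_of_real r * \<omega> ^ m) ^ j) = (if j = 0 then of_nat n else 0)"
    if "j \<le> d" for j
  proof (cases "j = 0")
    case False
    have "\<omega> ^ j = exp (2 * of_real pi * \<i> * of_nat j / of_nat n)"
      by (simp add: \<omega>_def exp_of_nat_mult[symmetric] mult_ac)
    moreover have "\<not> n dvd j" using False that by (auto simp: n_def dest: dvd_imp_le)
    ultimately have ne: "\<omega> ^ j \<noteq> 1" using complex_root_unity_eq_1[of n j] by (simp add: n_def)
    have "(\<Sum>m<n. (\<omega> ^ j) ^ m) = ((\<omega> ^ j) ^ n - 1) / (\<omega> ^ j - 1)"
      using ne by (rule geometric_sum)
    also have "(\<omega> ^ j) ^ n = 1" using \<omega>n by (metis power_mult mult.commute power_one)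
    finally have "(\<Sum>m<n. (\<omega> ^ j) ^ m) = 0" by simp
    moreover have "(\<Sum>m<n. (complex_of_real r * \<omega> ^ m) ^ j) = of_real r ^ j * (\<Sum>m<n. (\<omega> ^ j) ^ m)"
      by (simp add: sum_distrib_left power_mult_distrib power_mult[symmetric] mult.commute)
    ultimately show ?thesis using False by simp
  qed simp
  have sumC: "sum f A *\<^sub>C x = (\<Sum>m\<in>A. f m *\<^sub>C x)" for f :: "nat \<Rightarrow> complex" and A and x :: 'a
    by (induction A rule: infinite_finite_induct) (simp_all add: scaleC_add_left)
  have "(\<Sum>m<n. p (of_real r * \<omega> ^ m)) = (\<Sum>j\<le>d. \<Sum>m<n. ((of_real r * \<omega> ^ m) ^ j) *\<^sub>C c j)"
    unfolding dc by (rule sum.swap)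
  also have "\<dots> = (\<Sum>j\<le>d. (if j = 0 then of_nat n else 0) *\<^sub>C c j)"
    by (rule sum.cong) (simp_all only: sumC[symmetric] root_sum atMost_iff)
  also have "\<dots> = (\<Sum>j\<le>d. if j = 0 then of_nat n *\<^sub>C c 0 else 0)"
    by (rule sum.cong) auto
  also have "\<dots> = of_nat n *\<^sub>C c 0" by simp
  also have "c 0 = p 0" 
  proof -
    have "p 0 = (\<Sum>j\<le>d. if j = 0 then c 0 else 0)"
      unfolding dc by (rule sum.cong) (auto simp: power_0_left)
    then show ?thesis by simp
  qed
  finally have "norm (of_nat n *\<^sub>C p 0) \<le> (\<Sum>m<n. norm (p (of_real r * \<omega> ^ m)))"
    by (metis norm_sum)
  also have "\<dots> \<le> (\<Sum>m<n. M)"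
    by (rule sum_mono, rule bound) (simp add: norm_mult norm_power \<omega>1 r)
  finally have "real n * norm (p 0) \<le> real n * M" by (simp add: norm_scaleC)
  then show ?thesis by (simp add: n_def)
qed

section \<open>Quadratic vector fields tangent to the unit sphere vanish\<close>

text \<open>
  A homogeneous quadratic field \<open>q z = B z z\<close> is equivariant: \<open>q (\<omega> z) = \<omega>\<^sup>2 q z\<close>. Replacing \<open>z\<close> by \<open>\<omega> z\<close>
  with \<open>\<bar>\<omega>\<bar> = 1\<close> therefore extends the tangency estimate from real times to complex times \<open>\<epsilon>\<close>. Hence
  \<open>N\<close> Euler steps of length \<open>\<epsilon>\<close> with \<open>\<bar>\<epsilon>\<bar> = R / N\<close> stay in a fixed ball when \<open>N\<close> is large. The end point
  is a polynomial in \<open>\<epsilon>\<close> with linear coefficient \<open>N q z\<close>, and the Cauchy estimate bounds \<open>\<parallel>q z\<parallel>\<close> by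
  \<open>3 / R\<close> for every \<open>R\<close>, as in Liouville's theorem for the flow of \<open>q\<close>.
\<close>

lemma tangent_quadratic_zero:
  fixes B :: "'a::cstar_algebra \<Rightarrow> 'a \<Rightarrow> 'a"
  assumes B: "\<And>u v w. B (u + v) w = B u w + B v w" "\<And>u v w. B u (v + w) = B u v + B u w"
    "\<And>c u v. B (c *\<^sub>C u) v = c *\<^sub>C B u v" "\<And>c u v. B u (c *\<^sub>C v) = c *\<^sub>C B u v"
    and t0: "t0 > 0" and C: "C \<ge> 0"
    and tangent: "\<And>z t. norm z \<le> 1 \<Longrightarrow> 0 \<le> t \<Longrightarrow> t \<le> t0 \<Longrightarrow> norm (z + t *\<^sub>R B z z) \<le> 1 + C * t\<^sup>2"
  shows "B z z = 0"
proof -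
  have Bc: "B (c *\<^sub>C u) (c *\<^sub>C u) = (c * c) *\<^sub>C B u u" for c u
    by (simp add: B scaleC_scaleC)
  have B0: "B 0 0 = 0" using Bc[of 0 0] by simp
  have step: "norm (z + \<epsilon> *\<^sub>C B z z) \<le> norm z * (1 + 4 * C * (cmod \<epsilon>)\<^sup>2)"
    if z: "norm z \<le> 2" and \<epsilon>: "2 * cmod \<epsilon> \<le> t0" for z \<epsilon>
  proof (cases "z = 0")
    case True
    then show ?thesis by (simp add: B0)
  next
    case False
    define \<rho> where "\<rho> = norm z"
    have \<rho>: "0 < \<rho>" "\<rho> \<le> 2" using False z by (auto simp: \<rho>_def)
    define e where "e = cmod \<epsilon>"
    obtain \<omega> where \<omega>: "\<epsilon> = of_real e * \<omega>" "cmod \<omega> = 1"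
      using rcis_cmod_Arg[of \<epsilon>] unfolding e_def rcis_def by (metis norm_cis)
    \<comment> \<open>The unit vector \<open>u = \<omega> z / \<rho>\<close> carries a real step of length \<open>e \<rho>\<close> to \<open>c\<close> times the complex step at \<open>z\<close>.\<close>
    define c where "c = \<omega> / of_real \<rho>"
    have nc: "cmod c = 1 / \<rho>" using \<rho> \<omega> by (simp add: c_def norm_divide)
    define u where "u = c *\<^sub>C z"
    have u: "norm u \<le> 1" using \<rho> by (simp add: u_def norm_scaleC nc) (simp add: \<rho>_def)
    have "u + (e * \<rho>) *\<^sub>R B u u = c *\<^sub>C (z + \<epsilon> *\<^sub>C B z z)"
    proof -
      have eq: "complex_of_real (e * \<rho>) * (c * c) = c * \<epsilon>"
        using \<rho> by (simp add: c_def \<omega>(1))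
      show ?thesis
        unfolding u_def Bc scaleR_eq_scaleC scaleC_scaleC scaleC_add_right eq ..
    qed
    moreover have "norm (u + (e * \<rho>) *\<^sub>R B u u) \<le> 1 + C * (e * \<rho>)\<^sup>2"
    proof (rule tangent[OF u])
      show "0 \<le> e * \<rho>" using \<rho> by (simp add: e_def)
      have "e * \<rho> \<le> e * 2" using \<rho> by (intro mult_left_mono) (auto simp: e_def)
      then show "e * \<rho> \<le> t0" using \<epsilon> by (simp add: e_def)
    qed
    moreover have "C * (e * \<rho>)\<^sup>2 \<le> 4 * C * e\<^sup>2"
    proof -
      have "\<rho>\<^sup>2 \<le> 2\<^sup>2" using \<rho> by (intro power_mono) auto
      then have "C * e\<^sup>2 * \<rho>\<^sup>2 \<le> C * e\<^sup>2 * 4" using C by (intro mult_left_mono) auto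
      then show ?thesis by (simp add: power_mult_distrib mult_ac)
    qed
    ultimately have "norm (z + \<epsilon> *\<^sub>C B z z) / \<rho> \<le> 1 + 4 * C * e\<^sup>2" by (simp add: norm_scaleC nc)
    then show ?thesis using \<rho> by (simp add: e_def \<rho>_def[symmetric] field_simps)
  qed
  have small: "norm (B z z) \<le> 3 / R" if z: "norm z \<le> 1" and R: "R > 0" for z R
  proof -
    define P where "P k \<epsilon> = ((\<lambda>v. v + \<epsilon> *\<^sub>C B v v) ^^ k) z" for k \<epsilon>
    have PS: "P 0 \<epsilon> = z" "P (Suc k) \<epsilon> = P k \<epsilon> + \<epsilon> *\<^sub>C B (P k \<epsilon>) (P k \<epsilon>)" for k \<epsilon>
      by (simp_all add: P_def)
    \<comment> \<open>The first bound makes the step length admissible, the second keeps the Euler polygon bounded.\<close>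
    obtain N :: nat where N: "real N > max (2 * R / t0) (8 * C * R\<^sup>2 + 1)"
      using reals_Archimedean2 by blast
    have N0: "real N > 0" "N > 0"
    proof -
      have "8 * C * R\<^sup>2 \<ge> 0" using C by simp
      then show "real N > 0" using N by simp
      then show "N > 0" by simp
    qed
    define r where "r = R / N"
    have r: "r > 0" "2 * r \<le> t0"
      using R N N0 t0 by (auto simp: r_def field_simps)
    have growth: "(1 + 4 * C * r\<^sup>2) ^ N \<le> 2"
    proof -
      have "(1 + 4 * C * r\<^sup>2) ^ N \<le> exp (4 * C * r\<^sup>2) ^ N"
        using C by (intro power_mono exp_ge_add_one_self) auto
      also have "\<dots> = exp (real N * (4 * C * r\<^sup>2))" by (simp add: exp_of_nat_mult)
      also have "real N * (4 * C * r\<^sup>2) = 4 * C * R\<^sup>2 / N"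
        using N0 by (simp add: r_def power2_eq_square)
      also have "\<dots> \<le> 1 / 2" using N N0 by (simp add: field_simps)
      also have "exp (1 / 2) \<le> (2 :: real)" using exp_half_le2 by simp
      finally show ?thesis by simp
    qed
    have Pn: "norm (P k \<epsilon>) \<le> (1 + 4 * C * r\<^sup>2) ^ k" if "k \<le> N" "cmod \<epsilon> = r" for k \<epsilon>
      using that(1)
    proof (induction k)
      case (Suc k)
      have "(1 + 4 * C * r\<^sup>2) ^ k \<le> (1 + 4 * C * r\<^sup>2) ^ N"
        using Suc.prems C by (intro power_increasing) auto
      then have "norm (P k \<epsilon>) \<le> 2" using Suc growth by simp
      then have "norm (P (Suc k) \<epsilon>) \<le> norm (P k \<epsilon>) * (1 + 4 * C * r\<^sup>2)"
        using step[of "P k \<epsilon>" \<epsilon>] r that(2) by (simp add: PS)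
      also have "\<dots> \<le> (1 + 4 * C * r\<^sup>2) ^ k * (1 + 4 * C * r\<^sup>2)"
        using Suc C by (intro mult_right_mono) auto
      finally show ?case by (simp add: mult.commute)
    qed (simp add: PS z)
    have poly: "\<exists>p. vpoly p \<and> (\<forall>\<epsilon>. P k \<epsilon> = z + \<epsilon> *\<^sub>C (of_nat k *\<^sub>C B z z + \<epsilon> *\<^sub>C p \<epsilon>))" for k
    proof (induction k)
      case 0
      show ?case by (intro exI[of _ "\<lambda>_. 0"]) (simp add: PS vpoly.const)
    next
      case (Suc k)
      then obtain p where p: "vpoly p"
        "\<And>\<epsilon>. P k \<epsilon> = z + \<epsilon> *\<^sub>C (of_nat k *\<^sub>C B z z + \<epsilon> *\<^sub>C p \<epsilon>)" by blast
      define g where "g \<epsilon> = of_nat k *\<^sub>C B z z + \<epsilon> *\<^sub>C p \<epsilon>" for \<epsilon>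
      have g: "vpoly g" unfolding g_def using p(1) by (rule vpoly.step)
      have Pg: "P k \<epsilon> = z + \<epsilon> *\<^sub>C g \<epsilon>" for \<epsilon> by (simp add: p(2) g_def)
      define h where "h \<epsilon> = p \<epsilon> + (B z (g \<epsilon>) + B (g \<epsilon>) z + \<epsilon> *\<^sub>C B (g \<epsilon>) (g \<epsilon>))" for \<epsilon>
      have "vpoly h" unfolding h_def
        using vpoly_bilinear[of B, OF B] g p(1) vpoly.const by (intro vpoly_add vpoly_shift) blast+
      moreover have "P (Suc k) \<epsilon> = z + \<epsilon> *\<^sub>C (of_nat (Suc k) *\<^sub>C B z z + \<epsilon> *\<^sub>C h \<epsilon>)" for \<epsilon>
      proof -
        have "P (Suc k) \<epsilon> = z + \<epsilon> *\<^sub>C (g \<epsilon> + B (z + \<epsilon> *\<^sub>C g \<epsilon>) (z + \<epsilon> *\<^sub>C g \<epsilon>))"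
          by (simp add: PS Pg scaleC_add_right add.assoc)
        also have "B (z + \<epsilon> *\<^sub>C g \<epsilon>) (z + \<epsilon> *\<^sub>C g \<epsilon>)
            = B z z + \<epsilon> *\<^sub>C (B z (g \<epsilon>) + B (g \<epsilon>) z + \<epsilon> *\<^sub>C B (g \<epsilon>) (g \<epsilon>))"
          by (simp add: B scaleC_add_right ac_simps)
        also have "g \<epsilon> + (B z z + \<epsilon> *\<^sub>C (B z (g \<epsilon>) + B (g \<epsilon>) z + \<epsilon> *\<^sub>C B (g \<epsilon>) (g \<epsilon>)))
            = of_nat (Suc k) *\<^sub>C B z z + \<epsilon> *\<^sub>C h \<epsilon>"
          by (subst g_def) (simp add: h_def scaleC_add_right scaleC_add_left ac_simps)
        finally show ?thesis .
      qed
      ultimately show ?case by blast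
    qed
    obtain p where p: "vpoly p" "\<And>\<epsilon>. P N \<epsilon> = z + \<epsilon> *\<^sub>C (of_nat N *\<^sub>C B z z + \<epsilon> *\<^sub>C p \<epsilon>)"
      using poly[of N] by blast
    \<comment> \<open>The difference quotient \<open>(P N \<epsilon> - z) / \<epsilon>\<close>, extended to \<open>\<epsilon> = 0\<close>.\<close>
    let ?s = "\<lambda>\<epsilon>. of_nat N *\<^sub>C B z z + \<epsilon> *\<^sub>C p \<epsilon>"
    have "norm (?s 0) \<le> 3 / r"
    proof (rule vpoly_norm_center_le[of ?s r])
      show "vpoly ?s" using p(1) by (rule vpoly.step)
      fix \<epsilon> assume \<epsilon>: "cmod \<epsilon> = r"
      have "norm (\<epsilon> *\<^sub>C ?s \<epsilon>) = norm (P N \<epsilon> - z)" by (simp add: p(2))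
      also have "\<dots> \<le> norm (P N \<epsilon>) + norm z" by (rule norm_triangle_ineq4)
      also have "\<dots> \<le> 2 + 1" using Pn[OF order_refl \<epsilon>] growth z by (intro add_mono) auto
      finally show "norm (?s \<epsilon>) \<le> 3 / r" using r \<epsilon> by (simp add: norm_scaleC field_simps)
    qed (use r in simp)
    then have "real N * norm (B z z) \<le> 3 * N / R" by (simp add: norm_scaleC r_def)
    then show ?thesis using N0 R by (simp add: field_simps)
  qed
  have zero: "B z z = 0" if z: "norm z \<le> 1" for z
  proof (rule ccontr)
    assume "B z z \<noteq> 0"
    then have "norm (B z z) \<le> norm (B z z) * (3 / 4)"
      using small[OF z, of "4 / norm (B z z)"] by simp
    with \<open>B z z \<noteq> 0\<close> show False by simp
  qed
  show ?thesis
  proof (cases "z = 0")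
    case False
    define c where "c = complex_of_real (1 / norm z)"
    have "B (c *\<^sub>C z) (c *\<^sub>C z) = 0"
      using False by (intro zero) (simp add: norm_scaleC c_def norm_divide)
    then have "norm ((c * c) *\<^sub>C B z z) = 0" by (simp add: Bc)
    then show ?thesis using False by (simp add: norm_scaleC c_def norm_mult norm_divide)
  qed (simp add: B0)
qed

section \<open>Linear isometries preserve the triple product\<close>

text \<open>
  The field \<open>X\<^sub>a z = a - z a\<^sup>* z\<close> is tangent to the unit sphere, and so is its transform
  \<open>z \<mapsto> g (X\<^sub>a (h z))\<close> under the isometry \<open>g\<close>. The difference of this transform and \<open>X\<^sub>b\<close> for \<open>b = g a\<close> has no
  constant term, so that it is homogeneous of degree \<open>2\<close> and must vanish.
\<close>

lemma isometry_preserves_triple: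
  fixes g h :: "'a::cstar_algebra \<Rightarrow> 'a"
  assumes g: "clinear g" and h: "clinear h"
    and gh: "\<And>x. g (h x) = x" and hg: "\<And>x. h (g x) = x" and iso: "\<And>x. norm (g x) = norm x"
  shows "g (x * star a * x) = g x * star (g a) * g x"
proof -
  have isoh: "norm (h z) = norm z" for z using iso[of "h z"] gh by simp
  define b where "b = g a"
  have nb: "norm b = norm a" by (simp add: b_def iso)
  define B where "B u v = g (h u * star a * h v) - u * star b * v" for u v
  \<comment> \<open>The tangency estimate is used at time \<open>2 t\<close> and needs \<open>2 t \<parallel>a\<parallel> \<le> 2 / 5\<close>.\<close>
  define t0 where "t0 = 1 / (5 * (norm a + 1))"
  have a1: "0 < norm a + 1" by (rule add_nonneg_pos) auto
  have t0: "t0 > 0" using a1 by (simp add: t0_def)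
  have t0a: "t0 * norm a \<le> 1 / 5" using a1 by (simp add: t0_def field_simps)
  have "B (g x) (g x) = 0"
  proof (rule tangent_quadratic_zero[where B = B and C = "12 * (norm a)\<^sup>2", OF _ _ _ _ t0])
    show "B (u + v) w = B u w + B v w" "B u (v + w) = B u v + B u w"
      "B (c *\<^sub>C u) v = c *\<^sub>C B u v" "B u (c *\<^sub>C v) = c *\<^sub>C B u v" for u v w c
      by (simp_all add: B_def clinearD[OF g] clinearD[OF h] distrib_left distrib_right
          mult_scaleC_left mult_scaleC_right scaleC_diff_right)
    fix z :: 'a and t :: real assume z: "norm z \<le> 1" and t: "0 \<le> t" "t \<le> t0"
    have "t * norm a \<le> 1 / 5" using mult_right_mono[OF t(2), of "norm a"] t0a by simp
    then have s: "\<bar>2 * t\<bar> * norm a \<le> 2 / 5" "\<bar>- (2 * t)\<bar> * norm a \<le> 2 / 5" using t by simp_all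
    have 1: "norm (z + (2 * t) *\<^sub>R (b - z * star b * z)) \<le> 1 + 3 * (2 * t)\<^sup>2 * (norm a)\<^sup>2"
      using tangent_norm_le[OF z, of "2 * t" b] s(1) by (simp add: nb)
    have "norm (g (h z + (- (2 * t)) *\<^sub>R (a - h z * star a * h z))) \<le> 1 + 3 * (- (2 * t))\<^sup>2 * (norm a)\<^sup>2"
      unfolding iso by (rule tangent_norm_le) (use z s in \<open>simp_all add: isoh\<close>)
    then have 2: "norm (z - (2 * t) *\<^sub>R (b - g (h z * star a * h z))) \<le> 1 + 3 * (2 * t)\<^sup>2 * (norm a)\<^sup>2"
      by (simp add: clinearD[OF g] gh b_def)
    have "2 *\<^sub>R (z + t *\<^sub>R B z z) = (z + (2 * t) *\<^sub>R (b - z * star b * z))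
        + (z - (2 * t) *\<^sub>R (b - g (h z * star a * h z)))"
      by (simp add: B_def algebra_simps scaleR_2)
    then have "norm (2 *\<^sub>R (z + t *\<^sub>R B z z)) \<le> 2 * (1 + 3 * (2 * t)\<^sup>2 * (norm a)\<^sup>2)"
      using norm_triangle_mono[OF 1 2] by (simp only: mult_2)
    then have "2 * norm (z + t *\<^sub>R B z z) \<le> 2 * (1 + 3 * (2 * t)\<^sup>2 * (norm a)\<^sup>2)"
      by (simp only: norm_scaleR)
    then show "norm (z + t *\<^sub>R B z z) \<le> 1 + 12 * (norm a)\<^sup>2 * t\<^sup>2"
      by (simp add: power_mult_distrib mult_ac)
  qed simp
  then show ?thesis by (simp add: B_def b_def hg)
qed

section \<open>Dissipative operators are triple derivations\<close>

text \<open>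
  Solutions of \<open>w' = T w\<close> have constant norm, so they are determined by their initial values. Linearity
  of the time-\<open>s\<close> map and the group law are instances of this uniqueness.
\<close>

lemma dissipative_flow:
  fixes T :: "'a::cstar_algebra \<Rightarrow> 'a"
  assumes T: "clinear T" and diss: "\<And>x t. norm x \<le> norm (x - t *\<^sub>R T x)"
  obtains E where "\<And>x. E 0 x = x" "\<And>x s. ((\<lambda>s. E s x) has_vector_derivative T (E s x)) (at s)"
    "\<And>s. clinear (E s)" "\<And>s x. norm (E s x) = norm x" "\<And>s r x. E (s + r) x = E s (E r x)"
proof -
  have bT: "bounded_linear T"
    using clinearD(6)[OF T] diss by (rule dissipative_bounded)
  have "\<exists>w. w 0 = x \<and> (\<forall>s. (w has_vector_derivative T (w s)) (at s))" for x
    using bounded_linear_flow_exists[OF bT, of x] by metis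
  then obtain W where W: "\<And>x. W x 0 = x" "\<And>x s. (W x has_vector_derivative T (W x s)) (at s)"
    by metis
  note const = dissipative_solution_norm_const[OF bT diss]
  have unique: "u s = v s"
    if "\<And>s. (u has_vector_derivative T (u s)) (at s)" "\<And>s. (v has_vector_derivative T (v s)) (at s)"
      "u 0 = v 0" for u v s
  proof -
    have "((\<lambda>s. u s - v s) has_vector_derivative T (u s - v s)) (at s)" for s
      unfolding clinearD(4)[OF T] by (intro has_vector_derivative_diff that)
    from const[of "\<lambda>s. u s - v s", OF this, of s] show ?thesis using that(3) by simp
  qed
  have add: "W (x + y) s = W x s + W y s" for x y s
  proof (rule unique[OF W(2)])
    show "((\<lambda>s. W x s + W y s) has_vector_derivative T (W x s + W y s)) (at s)" for s
      unfolding clinearD(1)[OF T] by (intro has_vector_derivative_add W)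
  qed (simp add: W)
  have scale: "W (c *\<^sub>C x) s = c *\<^sub>C W x s" for c x s
  proof (rule unique[OF W(2)])
    show "((\<lambda>s. c *\<^sub>C W x s) has_vector_derivative T (c *\<^sub>C W x s)) (at s)" for s
      unfolding clinearD(2)[OF T]
      by (rule bounded_linear.has_vector_derivative[OF bounded_linear_scaleC W(2)])
  qed (simp add: W)
  have group: "W x (s + r) = W (W x r) s" for x s r
  proof (rule unique[OF _ W(2), of "\<lambda>s. W x (s + r)"])
    show "((\<lambda>s. W x (s + r)) has_vector_derivative T (W x (s + r))) (at s)" for s
      using vector_diff_chain_at[of "\<lambda>s. s + r" 1 s "W x", OF _ W(2)]
      by (simp add: o_def has_vector_derivative_add_const)
  qed (simp add: W)
  show thesis
  proof (rule that[of "\<lambda>s x. W x s"])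
    show "clinear (\<lambda>x. W x s)" for s by (rule clinearI) (simp_all add: add scale)
    show "norm (W x s) = norm x" for s x using const[OF W(2), of x s] by (simp add: W)
  qed (simp_all add: W group)
qed

text \<open>
  The isometries \<open>E s\<close> satisfy \<open>E s (x a\<^sup>* x) = (E s x) (E s a)\<^sup>* (E s x)\<close>. Both sides are differentiated at
  \<open>s = 0\<close>.
\<close>

lemma dissipative_derivation:
  fixes T :: "'a::cstar_algebra \<Rightarrow> 'a"
  assumes T: "clinear T" and diss: "\<And>x t. norm x \<le> norm (x - t *\<^sub>R T x)"
  shows "T (x * star a * x) = T x * star a * x + x * star (T a) * x + x * star a * T x"
proof -
  obtain E where E: "\<And>x. E 0 x = x" "\<And>x s. ((\<lambda>s. E s x) has_vector_derivative T (E s x)) (at s)"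
    "\<And>s. clinear (E s)" "\<And>s x. norm (E s x) = norm x" "\<And>s r x. E (s + r) x = E s (E r x)"
    using dissipative_flow[OF T diss] by blast
  have inv: "E s (E (- s) y) = y" for s y using E(5)[of s "- s" y] E(1) by simp
  have hom: "E s (x * star a * x) = E s x * star (E s a) * E s x" for s
    using inv[of "- s"] by (intro isometry_preserves_triple[OF E(3) E(3)[of "- s"]] inv E(4)) simp
  have d: "((\<lambda>s. E s y) has_vector_derivative T y) (at 0)" for y
    using E(2)[of y 0] by (simp add: E(1))
  have "((\<lambda>s. E s x * star (E s a) * E s x) has_vector_derivative
      (E 0 x * star (E 0 a)) * T x + (E 0 x * star (T a) + T x * star (E 0 a)) * E 0 x) (at 0)"
    by (intro has_vector_derivative_mult d bounded_linear.has_vector_derivative[OF bounded_linear_star])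
  then have "((\<lambda>s. E s (x * star a * x)) has_vector_derivative
      x * star a * T x + (x * star (T a) + T x * star a) * x) (at 0)"
    by (simp add: hom E(1))
  from vector_derivative_unique_at[OF d this] show ?thesis by (simp add: algebra_simps)
qed

text \<open>
  Since \<open>{x, a, x} = x a\<^sup>* x\<close> is quadratic in \<open>x\<close>, polarisation with \<open>x = a + c\<close> recovers the triple
  product.
\<close>

lemma triple_derivationI:
  fixes T :: "'a::cstar_algebra \<Rightarrow> 'a"
  assumes T: "clinear T"
    and quad: "\<And>x a. T (x * star a * x) = T x * star a * x + x * star (T a) * x + x * star a * T x"
  shows "triple_derivation T"
proof -
  have "T (triple_product a b c) =
      triple_product (T a) b c + triple_product a (T b) c + triple_product a b (T c)" for a b c
  proof -
    have eq: "a * star b * c + c * star b * a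
        = (a + c) * star b * (a + c) - a * star b * a - c * star b * c" for b
      by (simp add: algebra_simps)
    have "T (a * star b * c + c * star b * a) =
        T a * star b * c + c * star b * T a + (a * star (T b) * c + c * star (T b) * a)
        + (a * star b * T c + T c * star b * a)"
      unfolding eq clinearD(4)[OF T] quad by (simp add: clinearD[OF T] algebra_simps)
    then show ?thesis
      by (simp add: triple_product_def clinearD(3)[OF T] scaleR_add_right[symmetric])
  qed
  then show ?thesis using T by (simp add: triple_derivation_def)
qed

theorem theorem3p1:
  fixes T :: "'a::cstar_algebra \<Rightarrow> 'a"
  assumes "local_triple_derivation T"
  shows "triple_derivation T"
proof -
  have T: "clinear T" using assms by (simp add: local_triple_derivation_def)
  then show ?thesis
    by (rule triple_derivationI)
      (rule dissipative_derivation[OF T local_triple_derivation_dissipative[OF assms]])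
qed

end
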